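(* For every $N\ge2$: (i) $\widehat\theta\sim\mathcal N(\theta,\alpha^{2}/d_N)$; in particular $\widehat\theta$ is unbiased; (ii) $N\widehat\alpha^{\,2}/\alpha^{2}\sim\chi^{2}_{N-1}$ (chi-square law with $N-1$ degrees of freedom); (iii) $\widehat\theta$ and $\widehat\alpha^{\,2}$ are independent.
   Context: Fix a mesh $h>0$, an integer $m\ge1$ and known Hurst parameters $H_1,\dots,H_m\in(1/2,1)$. Let $B^{H_1},\dots,B^{H_m}$ be independent fractional Brownian motions, i.e. independent centred continuous Gaussian processes with $B^{H_r}(0)=0$ and $\mathbb E[B^{H_r}(t)B^{H_r}(s)]=\frac12(t^{2H_r}+s^{2H_r}-|t-s|^{2H_r})$ for $s,t\ge0$. For $\theta\in\mathbb R$ and $\alpha>0$ set $Z(t)=\theta t+\alpha\sum_{r=1}^m B^{H_r}(t)$, $t_k=kh$, $\mathbf T=(t_1,\dots,t_N)^\top$, $\mathbf Z=(Z(t_1),\dots,Z(t_N))^\top$. Let $\Gamma_H=\sum_{r=1}^m\Gamma_{H_r}$ be the $N\times N$ positive definite matrix with $(\Gamma_{H_r})_{ij}=\frac12(t_i^{2H_r}+t_j^{2H_r}-|t_i-t_j|^{2H_r})$. Put $d_N=\mathbf T^\top\Gamma_H^{-1}\mathbf T>0$ and $$\widehat\theta=\frac{\mathbf T^\top\Gamma_H^{-1}\mathbf Z}{d_N},\qquad \widehat\alpha^{\,2}=\frac1N\left(\mathbf Z^\top\Gamma_H^{-1}\mathbf Z-\frac{(\mathbf T^\top\Gamma_H^{-1}\mathbf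 Z)^2}{d_N}\right).$$ *)

theory Defs
  imports "HOL-Probability.Probability" "Jordan_Normal_Form.Gauss_Jordan_Elimination"
begin

text \<open>A Gaussian law may be degenerate, i.e. concentrated in one point.\<close>

definition gaussian_rv :: "'a measure \<Rightarrow> ('a \<Rightarrow> real) \<Rightarrow> bool" where
  "gaussian_rv M X \<longleftrightarrow> X \<in> borel_measurable M \<and>
     ((\<exists>\<mu> \<sigma>. 0 < \<sigma> \<and> distributed M lborel X (\<lambda>x. ennreal (normal_density \<mu> \<sigma> x))) \<or>
      (\<exists>\<mu>. AE \<omega> in M. X \<omega> = \<mu>))"

definition gaussian_process :: "'a measure \<Rightarrow> real set \<Rightarrow> (real \<Rightarrow> 'a \<Rightarrow> real) \<Rightarrow> bool" where
  "gaussian_process M I X \<longleftrightarrow>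
     (\<forall>F c. finite F \<and> F \<subseteq> I \<longrightarrow> gaussian_rv M (\<lambda>\<omega>. \<Sum>t\<in>F. c t * X t \<omega>))"

definition fbm_cov :: "real \<Rightarrow> real \<Rightarrow> real \<Rightarrow> real" where
  "fbm_cov H s t = (s powr (2 * H) + t powr (2 * H) - \<bar>s - t\<bar> powr (2 * H)) / 2"

text \<open>Path continuity and the initial value are required almost surely only. The values of
  \<open>B\<close> at negative times are irrelevant.\<close>

definition fractional_brownian_motion ::
    "'a measure \<Rightarrow> real \<Rightarrow> (real \<Rightarrow> 'a \<Rightarrow> real) \<Rightarrow> bool" where
  "fractional_brownian_motion M H B \<longleftrightarrow>
     gaussian_process M {0..} B \<and>
     (AE \<omega> in M. continuous_on {0..} (\<lambda>t. B t \<omega>)) \<and>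
     (AE \<omega> in M. B 0 \<omega> = 0) \<and>
     (\<forall>t\<ge>0. prob_space.expectation M (B t) = 0) \<and>
     (\<forall>s\<ge>0. \<forall>t\<ge>0. prob_space.expectation M (\<lambda>\<omega>. B t \<omega> * B s \<omega>) = fbm_cov H t s)"

text \<open>Independence of whole processes: each one is regarded as a random element of
  \<open>\<real>\<^bsup>[0,\<infinity>)\<^esup>\<close> with the product \<open>\<sigma>\<close>-algebra.\<close>

definition indep_processes ::
    "'a measure \<Rightarrow> 'i set \<Rightarrow> ('i \<Rightarrow> real \<Rightarrow> 'a \<Rightarrow> real) \<Rightarrow> bool" where
  "indep_processes M R B \<longleftrightarrow>
     prob_space.indep_vars M (\<lambda>_. PiM {0..} (\<lambda>_. borel)) (\<lambda>r \<omega>. \<lambda>t\<in>{0..}. B r t \<omega>) R"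

text \<open>The chi-square law with \<open>k\<close> degrees of freedom: the law of the sum of the squares of
  \<open>k\<close> independent standard normal variables.\<close>

definition chi_square_law :: "nat \<Rightarrow> real measure" where
  "chi_square_law k =
     distr (PiM {..<k} (\<lambda>_. density lborel (\<lambda>x. ennreal (std_normal_density x)))) borel
       (\<lambda>x. \<Sum>i<k. (x i)\<^sup>2)"

text \<open>The observed process and the discrete-time data. Vectors and matrices are indexed from
  \<open>0\<close>, so that entry \<open>i\<close> belongs to the time \<open>t\<^sub>i\<^sub>+\<^sub>1 = (i + 1) h\<close>.\<close>

definition Z_proc ::
    "real \<Rightarrow> real \<Rightarrow> nat \<Rightarrow> (nat \<Rightarrow> real \<Rightarrow> 'a \<Rightarrow> real) \<Rightarrow> real \<Rightarrow> 'a \<Rightarrow> real" where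
  "Z_proc \<theta> \<alpha> m B t \<omega> = \<theta> * t + \<alpha> * (\<Sum>r=1..m. B r t \<omega>)"

definition obs_time :: "real \<Rightarrow> nat \<Rightarrow> real" where
  "obs_time h k = real k * h"

definition T_vec :: "real \<Rightarrow> nat \<Rightarrow> real Matrix.vec" where
  "T_vec h N = Matrix.vec N (\<lambda>i. obs_time h (i + 1))"

definition Z_vec :: "real \<Rightarrow> nat \<Rightarrow> (real \<Rightarrow> 'a \<Rightarrow> real) \<Rightarrow> 'a \<Rightarrow> real Matrix.vec" where
  "Z_vec h N Z \<omega> = Matrix.vec N (\<lambda>i. Z (obs_time h (i + 1)) \<omega>)"

definition Gamma_fbm :: "real \<Rightarrow> nat \<Rightarrow> real \<Rightarrow> real Matrix.mat" where
  "Gamma_fbm h N H =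
     Matrix.mat N N (\<lambda>(i, j). fbm_cov H (obs_time h (i + 1)) (obs_time h (j + 1)))"

text \<open>The entrywise sum of matrices; matrices of type \<open>mat\<close> do not form a monoid.\<close>

definition Gamma_sum :: "real \<Rightarrow> nat \<Rightarrow> nat \<Rightarrow> (nat \<Rightarrow> real) \<Rightarrow> real Matrix.mat" where
  "Gamma_sum h N m H = Matrix.mat N N (\<lambda>ij. \<Sum>r=1..m. Gamma_fbm h N (H r) $$ ij)"

text \<open>The bilinear form \<open>u\<^sup>T \<Gamma>\<^sup>-\<^sup>1 v\<close>. The function \<open>mat_inverse\<close> returns
  \<open>None\<close> exactly on singular matrices.\<close>

definition inv_form :: "real Matrix.mat \<Rightarrow> real Matrix.vec \<Rightarrow> real Matrix.vec \<Rightarrow> real" where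
  "inv_form \<Gamma> u v = scalar_prod u (the (mat_inverse \<Gamma>) *\<^sub>v v)"

definition d_N :: "real \<Rightarrow> nat \<Rightarrow> nat \<Rightarrow> (nat \<Rightarrow> real) \<Rightarrow> real" where
  "d_N h N m H = inv_form (Gamma_sum h N m H) (T_vec h N) (T_vec h N)"

definition theta_hat ::
    "real \<Rightarrow> nat \<Rightarrow> nat \<Rightarrow> (nat \<Rightarrow> real) \<Rightarrow> (real \<Rightarrow> 'a \<Rightarrow> real) \<Rightarrow> 'a \<Rightarrow> real" where
  "theta_hat h N m H Z \<omega> =
     inv_form (Gamma_sum h N m H) (T_vec h N) (Z_vec h N Z \<omega>) / d_N h N m H"

text \<open>\<open>alpha2_hat\<close> is the estimator of \<open>\<alpha>\<^sup>2\<close>, not of \<open>\<alpha>\<close>.\<close>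

definition alpha2_hat ::
    "real \<Rightarrow> nat \<Rightarrow> nat \<Rightarrow> (nat \<Rightarrow> real) \<Rightarrow> (real \<Rightarrow> 'a \<Rightarrow> real) \<Rightarrow> 'a \<Rightarrow> real" where
  "alpha2_hat h N m H Z \<omega> =
     (1 / real N) *
       (inv_form (Gamma_sum h N m H) (Z_vec h N Z \<omega>) (Z_vec h N Z \<omega>)
        - (inv_form (Gamma_sum h N m H) (T_vec h N) (Z_vec h N Z \<omega>))\<^sup>2 / d_N h N m H)"

end

theory Submission
  imports Defs "Jordan_Normal_Form.Determinant"
begin

text \<open>Put \<open>X\<^sub>i = \<Sum>\<^sub>r B\<^sup>H\<^sup>r(t\<^sub>i)\<close>, a centred Gaussian vector with covariance \<open>\<Gamma>\<close>. Choose a basis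
  \<open>a\<^sub>0, \<dots>, a\<^sub>N\<^sub>-\<^sub>1\<close> that is orthonormal for the form \<open>\<Gamma>\<close> and starts with
  \<open>a\<^sub>0 = \<Gamma>\<^sup>-\<^sup>1T / \<surd>d\<^sub>N\<close>. Then \<open>u\<^sup>T\<Gamma>\<^sup>-\<^sup>1v = \<Sum>\<^sub>k (a\<^sub>k \<bullet> u)(a\<^sub>k \<bullet> v)\<close>, the variables \<open>Y\<^sub>k = a\<^sub>k \<bullet> X\<close> are
  independent standard normal, and \<open>a\<^sub>k \<bullet> T = 0\<close> for \<open>k > 0\<close>. The estimators become
  \<open>\<theta> + \<alpha> Y\<^sub>0 / \<surd>d\<^sub>N\<close> and \<open>(\<alpha>\<^sup>2 / N) \<Sum>\<^sub>k\<^sub>>\<^sub>0 Y\<^sub>k\<^sup>2\<close>, which gives all three claims.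

  Positive definiteness of \<open>\<Gamma>\<close> comes from
  \<open>\<bar>t\<bar>\<^sup>2\<^sup>H = const * \<integral>\<^sub>x\<^sub>>\<^sub>0 (1 - cos(t x)) x\<^sup>-\<^sup>1\<^sup>-\<^sup>2\<^sup>H dx\<close>. Independence of the \<open>Y\<^sub>k\<close> comes from the
  factorisation of their joint characteristic function (Kac's theorem).\<close>

subsection \<open>Bases that are orthonormal for a positive definite matrix\<close>

text \<open>A singular matrix has a nonzero kernel vector, and the form vanishes on it.\<close>

lemma det_nonzero_if_definite:
  fixes G :: "real Matrix.mat"
  assumes G: "G \<in> carrier_mat n n"
    and pd: "\<And>v. v \<in> carrier_vec n \<Longrightarrow> v \<noteq> 0\<^sub>v n \<Longrightarrow> 0 < scalar_prod v (G *\<^sub>v v)"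
  shows "det G \<noteq> 0"
proof
  assume "det G = 0"
  then obtain v where "v \<in> carrier_vec n" "v \<noteq> 0\<^sub>v n" "G *\<^sub>v v = 0\<^sub>v n"
    using det_0_iff_vec_prod_zero_field[OF G] by blast
  with pd[of v] show False by simp
qed

text \<open>\<open>inv_form\<close> takes \<open>the\<close> of \<open>mat_inverse\<close>. A
  nonzero determinant makes the matrix a unit, which excludes the result
  \<open>None\<close>.\<close>

lemma mat_inverse_exists:
  fixes G :: "'a :: field Matrix.mat"
  assumes G: "G \<in> carrier_mat n n" and det: "det G \<noteq> 0"
  obtains C where "mat_inverse G = Some C" "C \<in> carrier_mat n n" "G * C = 1\<^sub>m n" "C * G = 1\<^sub>m n"
proof (cases "mat_inverse G")
  case None
  with mat_inverse(1)[OF G None, of "()"] det_non_zero_imp_unit[OF G det, of "()"] show ?thesis by blast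
next
  case (Some C)
  with mat_inverse(2)[OF G Some] that show ?thesis by blast
qed

text \<open>Fewer than \<open>n\<close> linear conditions on \<open>n\<close> unknowns: padded with
  zero rows, the vectors \<open>u i\<close> form a singular square matrix, and any nonzero kernel
  vector will do.\<close>

lemma exists_nonzero_orthogonal_vec:
  fixes u :: "nat \<Rightarrow> 'a :: field Matrix.vec"
  assumes k: "k < n" and u: "\<And>i. i < k \<Longrightarrow> u i \<in> carrier_vec n"
  obtains v where "v \<in> carrier_vec n" "v \<noteq> 0\<^sub>v n" "\<And>i. i < k \<Longrightarrow> scalar_prod (u i) v = 0"
proof -
  define w where "w i = (if i < k then u i else 0\<^sub>v n)" for i
  have w: "w i \<in> carrier_vec n" for i using u by (simp add: w_def)
  define A where "A = mat\<^sub>r n n (\<lambda>i. if i = k then 0\<^sub>v n else w i)"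
  have A: "A \<in> carrier_mat n n" by (simp add: A_def)
  have "det A = 0" unfolding A_def by (rule det_row_0[OF k]) (use w in auto)
  then obtain v where v: "v \<in> carrier_vec n" "v \<noteq> 0\<^sub>v n" "A *\<^sub>v v = 0\<^sub>v n"
    using det_0_iff_vec_prod_zero_field[OF A] by blast
  have "scalar_prod (u i) v = 0" if i: "i < k" for i
  proof -
    have "row A i = u i" using i k u by (intro eq_vecI) (auto simp: A_def w_def)
    moreover have "(A *\<^sub>v v) $ i = 0" using v i k by simp
    ultimately show ?thesis using A i k by simp
  qed
  with v that show ?thesis by blast
qed

text \<open>Gram-Schmidt without projections: the next vector is chosen orthogonal to all
  \<open>G *\<^sub>v a i\<close> and divided by its \<open>G\<close>-norm. Indices run up to
  \<open>k\<close> inclusive, so \<open>k = n - 1\<close> gives a full basis.\<close>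

lemma exists_orthonormal_extension:
  fixes G :: "real Matrix.mat"
  assumes G: "G \<in> carrier_mat n n"
    and sym: "\<And>u v. u \<in> carrier_vec n \<Longrightarrow> v \<in> carrier_vec n \<Longrightarrow>
      scalar_prod u (G *\<^sub>v v) = scalar_prod v (G *\<^sub>v u)"
    and pd: "\<And>v. v \<in> carrier_vec n \<Longrightarrow> v \<noteq> 0\<^sub>v n \<Longrightarrow> 0 < scalar_prod v (G *\<^sub>v v)"
    and w: "w \<in> carrier_vec n" "scalar_prod w (G *\<^sub>v w) = 1"
  shows "Suc k \<le> n \<Longrightarrow> \<exists>a. a 0 = w \<and> (\<forall>i\<le>k. a i \<in> carrier_vec n) \<and>
    (\<forall>i\<le>k. \<forall>j\<le>k. scalar_prod (a i) (G *\<^sub>v a j) = (if i = j then 1 else 0))"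
proof (induction k)
  case 0
  show ?case using w by (intro exI[of _ "\<lambda>_. w"]) auto
next
  case (Suc k)
  then obtain a where a: "a 0 = w" "\<And>i. i \<le> k \<Longrightarrow> a i \<in> carrier_vec n"
    "\<And>i j. i \<le> k \<Longrightarrow> j \<le> k \<Longrightarrow> scalar_prod (a i) (G *\<^sub>v a j) = (if i = j then 1 else 0)"
    by (metis Suc_leD)
  obtain v where v: "v \<in> carrier_vec n" "v \<noteq> 0\<^sub>v n"
    "\<And>i. i < Suc k \<Longrightarrow> scalar_prod (G *\<^sub>v a i) v = 0"
    by (rule exists_nonzero_orthogonal_vec[of "Suc k" n "\<lambda>i. G *\<^sub>v a i"]) (use Suc.prems G a in auto)
  define r where "r = sqrt (scalar_prod v (G *\<^sub>v v))"
  have r: "r > 0" "r * r = scalar_prod v (G *\<^sub>v v)" using pd[OF v(1,2)] by (auto simp: r_def)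
  define b where "b = (1 / r) \<cdot>\<^sub>v v"
  have b: "b \<in> carrier_vec n" using v by (simp add: b_def)
  have Gb: "G *\<^sub>v b = (1 / r) \<cdot>\<^sub>v (G *\<^sub>v v)"
    unfolding b_def by (rule mult_mat_vec[OF G v(1)])
  have "scalar_prod b (G *\<^sub>v b) = 1"
    unfolding Gb unfolding b_def using r v G
    by (simp add: field_simps flip: r(2))
  moreover have vb: "scalar_prod b (G *\<^sub>v a i) = 0" if "i \<le> k" for i
  proof -
    have "scalar_prod v (G *\<^sub>v a i) = 0"
      using v(3)[of i] that comm_scalar_prod[of v n "G *\<^sub>v a i"] v(1) G a(2)[of i] by auto
    then show ?thesis using G a(2)[OF that] v by (simp add: b_def)
  qed
  moreover have "scalar_prod (a i) (G *\<^sub>v b) = 0" if "i \<le> k" for i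
    using vb[OF that] sym[OF a(2)[OF that] b] by simp
  ultimately show ?case using a b
    by (intro exI[of _ "a(Suc k := b)"]) (auto simp: le_Suc_eq)
qed

text \<open>If the rows of \<open>A\<close> are orthonormal for the form \<open>G\<close>, then \<open>A G A\<^sup>T = 1\<close>, whence
  \<open>G\<^sup>-\<^sup>1 = A\<^sup>T A\<close>.\<close>

lemma inv_form_eq_sum_orthonormal:
  assumes G: "G \<in> carrier_mat n n" and det: "det G \<noteq> 0"
    and a: "\<And>i. i < n \<Longrightarrow> a i \<in> carrier_vec n"
    and on: "\<And>i j. i < n \<Longrightarrow> j < n \<Longrightarrow>
      scalar_prod (a i) (G *\<^sub>v a j) = (if i = j then 1 else 0)"
    and u: "u \<in> carrier_vec n" and v: "v \<in> carrier_vec n"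
  shows "inv_form G u v = (\<Sum>i<n. scalar_prod (a i) u * scalar_prod (a i) v)"
proof -
  obtain C where C: "mat_inverse G = Some C" "C \<in> carrier_mat n n" "G * C = 1\<^sub>m n" "C * G = 1\<^sub>m n"
    by (rule mat_inverse_exists[OF G det])
  define A where "A = mat\<^sub>r n n a"
  have A: "A \<in> carrier_mat n n" by (simp add: A_def)
  have row: "row A i = a i" if "i < n" for i
    using that a[OF that] by (intro eq_vecI) (auto simp: A_def)
  have AT: "transpose_mat A \<in> carrier_mat n n" using A by simp
  have "A * (G * transpose_mat A) = 1\<^sub>m n"
  proof (rule eq_matI)
    fix i j assume "i < dim_row (1\<^sub>m n)" "j < dim_col (1\<^sub>m n)"
    then have ij: "i < n" "j < n" by auto
    then have "col (G * transpose_mat A) j = G *\<^sub>v a j"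
      using G A row[OF ij(2)] by (subst col_mult2[OF G AT ij(2)]) simp
    with ij on[OF ij] A G row show "(A * (G * transpose_mat A)) $$ (i, j) = 1\<^sub>m n $$ (i, j)"
      by simp
  qed (use A G in auto)
  \<comment> \<open>For square matrices a right inverse is also a left inverse; this moves
    \<open>A\<close> to the other side.\<close>
  from mat_mult_left_right_inverse[OF A _ this] G AT
  have "(G * transpose_mat A) * A = 1\<^sub>m n" by auto
  then have GA: "G * (transpose_mat A * A) = 1\<^sub>m n" using G A AT by simp
  have "C = C * (G * (transpose_mat A * A))" using C GA by simp
  also have "\<dots> = transpose_mat A * A"
    using C G A AT by (subst assoc_mult_mat[symmetric, OF C(2) G]) auto
  finally have CA: "C = transpose_mat A * A" .
  have "inv_form G u v = scalar_prod u (transpose_mat A *\<^sub>v (A *\<^sub>v v))"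
    using A AT v by (simp add: inv_form_def C(1) CA)
  also have "\<dots> = scalar_prod (A *\<^sub>v u) (A *\<^sub>v v)"
    using transpose_vec_mult_scalar[OF A u, of "A *\<^sub>v v"] A v comm_scalar_prod by (metis AT mult_mat_vec_carrier u)
  also have "\<dots> = (\<Sum>i<n. scalar_prod (a i) u * scalar_prod (a i) v)"
    using A row by (auto simp: scalar_prod_def[of "A *\<^sub>v u"] atLeast0LessThan intro!: sum.cong)
  finally show ?thesis .
qed

text \<open>\<open>G\<close> maps the first basis vector to a multiple of \<open>T\<close>.
  Orthonormality for \<open>G\<close> therefore makes the later \<open>a i\<close> orthogonal to
  \<open>T\<close> in the ordinary sense.\<close>

lemma exists_whitening:
  fixes G :: "real Matrix.mat"
  assumes G: "G \<in> carrier_mat n n"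
    and sym: "\<And>u v. u \<in> carrier_vec n \<Longrightarrow> v \<in> carrier_vec n \<Longrightarrow>
      scalar_prod u (G *\<^sub>v v) = scalar_prod v (G *\<^sub>v u)"
    and pd: "\<And>v. v \<in> carrier_vec n \<Longrightarrow> v \<noteq> 0\<^sub>v n \<Longrightarrow> 0 < scalar_prod v (G *\<^sub>v v)"
    and T: "T \<in> carrier_vec n" "T \<noteq> 0\<^sub>v n"
  obtains a where "\<And>i. i < n \<Longrightarrow> a i \<in> carrier_vec n"
    "\<And>i j. i < n \<Longrightarrow> j < n \<Longrightarrow> scalar_prod (a i) (G *\<^sub>v a j) = (if i = j then 1 else 0)"
    "\<And>u v. u \<in> carrier_vec n \<Longrightarrow> v \<in> carrier_vec n \<Longrightarrow>
      inv_form G u v = (\<Sum>i<n. scalar_prod (a i) u * scalar_prod (a i) v)"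
    "0 < inv_form G T T" "scalar_prod (a 0) T = sqrt (inv_form G T T)"
    "\<And>i. 0 < i \<Longrightarrow> i < n \<Longrightarrow> scalar_prod (a i) T = 0"
proof -
  have n: "0 < n" using T by (cases n) (auto intro!: eq_vecI)
  have det: "det G \<noteq> 0" using det_nonzero_if_definite[OF G pd] by blast
  obtain C where C: "mat_inverse G = Some C" "C \<in> carrier_mat n n" "G * C = 1\<^sub>m n" "C * G = 1\<^sub>m n"
    by (rule mat_inverse_exists[OF G det])
  define w where "w = C *\<^sub>v T"
  have w: "w \<in> carrier_vec n" using C T by (simp add: w_def)
  have Gw: "G *\<^sub>v w = T"
    using assoc_mult_mat_vec[OF G C(2) T(1)] C(3) T(1) by (simp add: w_def)
  have w0: "w \<noteq> 0\<^sub>v n" using Gw T G by auto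
  have d: "inv_form G T T = scalar_prod w (G *\<^sub>v w)"
    using comm_scalar_prod[OF T(1) w] by (simp add: inv_form_def C(1) Gw flip: w_def)
  have pos: "0 < inv_form G T T" unfolding d by (rule pd[OF w w0])
  define r where "r = sqrt (inv_form G T T)"
  have r: "0 < r" "r * r = inv_form G T T" using pos by (auto simp: r_def)
  define b where "b = (1 / r) \<cdot>\<^sub>v w"
  have b: "b \<in> carrier_vec n" using w by (simp add: b_def)
  have Gb: "G *\<^sub>v b = (1 / r) \<cdot>\<^sub>v T" unfolding b_def using mult_mat_vec[OF G w] Gw by simp
  have "scalar_prod b (G *\<^sub>v b) = 1"
    unfolding Gb unfolding b_def using r w T d Gw pos
    by (simp add: field_simps)
  from exists_orthonormal_extension[OF G sym pd b this, of "n - 1"] n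
  obtain a where a0: "a 0 = b" and a': "\<forall>i\<le>n - 1. a i \<in> carrier_vec n"
    "\<forall>i\<le>n - 1. \<forall>j\<le>n - 1. scalar_prod (a i) (G *\<^sub>v a j) = (if i = j then 1 else 0)"
    by auto
  have a: "a i \<in> carrier_vec n" if "i < n" for i using a'(1) that by auto
  have on: "scalar_prod (a i) (G *\<^sub>v a j) = (if i = j then 1 else 0)" if "i < n" "j < n" for i j
    using a'(2) that by auto
  have aT: "scalar_prod (a i) T = (if i = 0 then r else 0)" if "i < n" for i
    using on[OF that n] r a[OF that] T by (auto simp: a0 Gb split: if_splits)
  show ?thesis
    using inv_form_eq_sum_orthonormal[OF G det a on] a on aT n pos
    by (intro that[of a]) (auto simp: r_def)
qed

subsection \<open>Characteristic functions and independence\<close>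

text \<open>The law lives on the reals, so conjugation only flips the sign in the exponent. This
  serves to split complex weights into real parts.\<close>

lemma (in real_distribution) cnj_char_minus: "cnj (char M (- t)) = char M t"
  unfolding char_def by (simp add: exp_cnj flip: Bochner_Integration.integral_cnj)

text \<open>A nonnegative weight \<open>W\<close> of mean \<open>e > 0\<close> gives a new probability measure with density
  \<open>W / e\<close>, under which the law of \<open>Y\<close> is unchanged by Levy's uniqueness theorem. Bounded real
  weights are reduced to this case by adding a constant, complex ones by taking real parts.\<close>

lemma (in prob_space) expectation_mult_indicator_of_char_nonneg:
  fixes W Y :: "'a \<Rightarrow> real"
  assumes W[measurable]: "W \<in> borel_measurable M" and bound: "\<And>\<omega>. 0 \<le> W \<omega>" "\<And>\<omega>. W \<omega> \<le> K"
    and Y[measurable]: "Y \<in> borel_measurable M"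
    and char: "\<And>t. expectation (\<lambda>\<omega>. W \<omega> *\<^sub>R iexp (t * Y \<omega>)) =
      expectation W *\<^sub>R char (distr M borel Y) t"
    and A[measurable]: "A \<in> sets borel"
  shows "expectation (\<lambda>\<omega>. W \<omega> * indicat_real A (Y \<omega>)) =
    expectation W * prob (Y -` A \<inter> space M)"
proof -
  have intW: "integrable M W"
    by (rule integrable_const_bound[where B = K]) (use bound in auto)
  define e where "e = expectation W"
  have e0: "0 \<le> e" unfolding e_def using bound by (intro Bochner_Integration.integral_nonneg) auto
  show ?thesis
  proof (cases "e = 0")
    \<comment> \<open>A nonnegative weight of mean zero vanishes almost everywhere; normalising it
      would divide by zero.\<close>
    case True
    then have "AE \<omega> in M. W \<omega> = 0"
      using integral_nonneg_eq_0_iff_AE[OF intW] bound by (simp add: e_def)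
    then have "expectation (\<lambda>\<omega>. W \<omega> * indicat_real A (Y \<omega>)) = expectation (\<lambda>_. 0)"
      by (intro integral_cong_AE) auto
    with True show ?thesis by (simp add: e_def)
  next
    case False
    with e0 have e: "0 < e" by simp
    define D where "D = density M (\<lambda>\<omega>. ennreal (W \<omega> / e))"
    have dens: "integral\<^sup>L D f = expectation (\<lambda>\<omega>. (W \<omega> / e) *\<^sub>R f \<omega>)"
      if "f \<in> borel_measurable M" for f :: "'a \<Rightarrow> 'b :: {banach, second_countable_topology}"
      unfolding D_def using that bound e by (intro integral_density) auto
    have "emeasure D (space D) = 1"
    proof -
      have "emeasure D (space D) = (\<integral>\<^sup>+ \<omega>. ennreal (W \<omega> / e) \<partial>M)"
        unfolding D_def by (simp add: emeasure_density cong: nn_integral_cong)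
      also have "\<dots> = ennreal (expectation (\<lambda>\<omega>. W \<omega> / e))"
        using intW bound e by (intro nn_integral_eq_integral) auto
      also have "\<dots> = 1" using e by (simp flip: e_def)
      finally show ?thesis .
    qed
    then interpret D: prob_space D by (rule prob_spaceI)
    have YD[measurable]: "Y \<in> borel_measurable D" by (simp add: D_def)
    have "distr D borel Y = distr M borel Y"
    proof (rule Levy_uniqueness)
      show "real_distribution (distr D borel Y)" "real_distribution (distr M borel Y)"
        by (simp_all add: D.real_distribution_distr real_distribution_distr)
      show "char (distr D borel Y) = char (distr M borel Y)"
      proof
        fix t
        have "char (distr D borel Y) t = (CLINT \<omega>|D. iexp (t * Y \<omega>))"
          unfolding char_def by (simp add: integral_distr)
        also have "\<dots> = expectation (\<lambda>\<omega>. (1 / e) *\<^sub>R (W \<omega> *\<^sub>R iexp (t * Y \<omega>)))"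
          by (subst dens) auto
        also have "\<dots> = char (distr M borel Y) t"
          using char[of t] e by (simp only: integral_scaleR_right) (simp flip: e_def)
        finally show "char (distr D borel Y) t = char (distr M borel Y) t" .
      qed
    qed
    then have "(LINT x|distr D borel Y. indicat_real A x) = (LINT x|distr M borel Y. indicat_real A x)"
      by simp
    moreover have "(LINT x|distr D borel Y. indicat_real A x) =
      expectation (\<lambda>\<omega>. (1 / e) * (W \<omega> * indicat_real A (Y \<omega>)))"
      by (subst integral_distr) (auto simp: dens)
    moreover have "(LINT x|distr M borel Y. indicat_real A x) = prob (Y -` A \<inter> space M)"
      by (simp add: measure_distr)
    ultimately show ?thesis using e by (simp add: field_simps flip: e_def)
  qed
qed

lemma (in prob_space) expectation_mult_indicator_of_char_real:
  fixes W Y :: "'a \<Rightarrow> real"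
  assumes W[measurable]: "W \<in> borel_measurable M" and bound: "\<And>\<omega>. \<bar>W \<omega>\<bar> \<le> K"
    and Y[measurable]: "Y \<in> borel_measurable M"
    and char: "\<And>t. expectation (\<lambda>\<omega>. W \<omega> *\<^sub>R iexp (t * Y \<omega>)) =
      expectation W *\<^sub>R char (distr M borel Y) t"
    and A[measurable]: "A \<in> sets borel"
  shows "expectation (\<lambda>\<omega>. W \<omega> * indicat_real A (Y \<omega>)) =
    expectation W * prob (Y -` A \<inter> space M)"
proof -
  have int: "integrable M (\<lambda>\<omega>. W \<omega> *\<^sub>R f \<omega>)"
    if [measurable]: "f \<in> borel_measurable M" and f: "\<And>\<omega>. norm (f \<omega>) \<le> 1"
    for f :: "'a \<Rightarrow> 'b :: {banach, second_countable_topology}"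
    by (rule integrable_const_bound[where B = K])
      (use bound f in \<open>auto intro!: AE_I2 order_trans[OF mult_mono[OF bound f]] order_trans[OF abs_ge_zero bound]\<close>)
  have int1: "integrable M f" if [measurable]: "f \<in> borel_measurable M" and f: "\<And>\<omega>. norm (f \<omega>) \<le> 1"
    for f :: "'a \<Rightarrow> 'b :: {banach, second_countable_topology}"
    by (rule integrable_const_bound[where B = 1]) (use f in auto)
  have intW: "integrable M W" using int[of "\<lambda>_. 1::real"] by simp
  have iY: "prob (Y -` A \<inter> space M) = expectation (\<lambda>\<omega>. indicat_real A (Y \<omega>))"
  proof -
    have "expectation (\<lambda>\<omega>. indicat_real A (Y \<omega>)) = (LINT x|distr M borel Y. indicat_real A x)"
      by (subst integral_distr) auto
    then show ?thesis by (simp add: measure_distr)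
  qed
  \<comment> \<open>The shifted weight lies between 0 and \<open>2 * K\<close>. The constant weight
    \<open>K\<close> factorises by itself, so its contribution can be subtracted afterwards.\<close>
  have "expectation (\<lambda>\<omega>. (W \<omega> + K) * indicat_real A (Y \<omega>)) =
    expectation (\<lambda>\<omega>. W \<omega> + K) * prob (Y -` A \<inter> space M)"
  proof (rule expectation_mult_indicator_of_char_nonneg[where K = "2 * K"])
    fix \<omega> show "0 \<le> W \<omega> + K" "W \<omega> + K \<le> 2 * K" using bound[of \<omega>] by auto
  next
    fix t
    have "expectation (\<lambda>\<omega>. (W \<omega> + K) *\<^sub>R iexp (t * Y \<omega>)) =
      expectation (\<lambda>\<omega>. W \<omega> *\<^sub>R iexp (t * Y \<omega>) + K *\<^sub>R iexp (t * Y \<omega>))"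
      by (simp add: scaleR_add_left)
    also have "\<dots> = expectation (\<lambda>\<omega>. W \<omega> *\<^sub>R iexp (t * Y \<omega>)) + expectation (\<lambda>\<omega>. K *\<^sub>R iexp (t * Y \<omega>))"
      by (intro Bochner_Integration.integral_add int integrable_scaleR_right int1) auto
    also have "expectation (\<lambda>\<omega>. K *\<^sub>R iexp (t * Y \<omega>)) = K *\<^sub>R char (distr M borel Y) t"
      unfolding char_def by (simp only: integral_scaleR_right) (simp add: integral_distr)
    also have "expectation (\<lambda>\<omega>. W \<omega> *\<^sub>R iexp (t * Y \<omega>)) + \<dots> =
      expectation (\<lambda>\<omega>. W \<omega> + K) *\<^sub>R char (distr M borel Y) t"
      unfolding char using intW by (simp add: scaleR_add_left prob_space)
    finally show "expectation (\<lambda>\<omega>. (W \<omega> + K) *\<^sub>R iexp (t * Y \<omega>)) =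
      expectation (\<lambda>\<omega>. W \<omega> + K) *\<^sub>R char (distr M borel Y) t" .
  qed auto
  moreover have "expectation (\<lambda>\<omega>. (W \<omega> + K) * indicat_real A (Y \<omega>)) =
      expectation (\<lambda>\<omega>. W \<omega> * indicat_real A (Y \<omega>)) + K * prob (Y -` A \<inter> space M)"
  proof -
    have "expectation (\<lambda>\<omega>. (W \<omega> + K) * indicat_real A (Y \<omega>)) =
      expectation (\<lambda>\<omega>. W \<omega> *\<^sub>R indicat_real A (Y \<omega>) + K * indicat_real A (Y \<omega>))"
      by (simp add: distrib_right)
    also have "\<dots> = expectation (\<lambda>\<omega>. W \<omega> *\<^sub>R indicat_real A (Y \<omega>)) + expectation (\<lambda>\<omega>. K * indicat_real A (Y \<omega>))"
      by (intro Bochner_Integration.integral_add int integrable_mult_right int1) (auto simp: indicator_def)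
    finally show ?thesis by (simp add: iY)
  qed
  moreover have "expectation (\<lambda>\<omega>. W \<omega> + K) = expectation W + K"
    using intW by (simp add: prob_space)
  ultimately show ?thesis by (simp add: distrib_right)
qed

lemma (in prob_space) expectation_mult_indicator_of_char:
  fixes W :: "'a \<Rightarrow> complex" and Y :: "'a \<Rightarrow> real"
  assumes W[measurable]: "W \<in> borel_measurable M" and bound: "\<And>\<omega>. norm (W \<omega>) \<le> K"
    and Y[measurable]: "Y \<in> borel_measurable M"
    and char: "\<And>t. expectation (\<lambda>\<omega>. W \<omega> * iexp (t * Y \<omega>)) =
      expectation W * char (distr M borel Y) t"
    and A[measurable]: "A \<in> sets borel"
  shows "expectation (\<lambda>\<omega>. W \<omega> * of_real (indicat_real A (Y \<omega>))) =
    expectation W * of_real (prob (Y -` A \<inter> space M))"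
proof -
  interpret dY: real_distribution "distr M borel Y" by (simp add: real_distribution_distr)
  have int: "integrable M (\<lambda>\<omega>. W \<omega> * f \<omega>)"
    if [measurable]: "f \<in> borel_measurable M" and f: "\<And>\<omega>. norm (f \<omega>) \<le> 1" for f :: "'a \<Rightarrow> complex"
    by (rule integrable_const_bound[where B = K])
      (use bound f in \<open>auto simp: norm_mult intro!: AE_I2 order_trans[OF mult_mono[OF bound f]] order_trans[OF norm_ge_zero bound]\<close>)
  have intW: "integrable M W" using int[of "\<lambda>_. 1"] by simp
  \<comment> \<open>The factor \<open>c\<close> treats both parts at once: \<open>c = 1\<close>
    selects the real part of \<open>W\<close>, and \<open>c = - \<i>\<close> its imaginary
    part.\<close>
  have part: "expectation (\<lambda>\<omega>. Re (c * W \<omega>) * indicat_real A (Y \<omega>)) =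
      expectation (\<lambda>\<omega>. Re (c * W \<omega>)) * prob (Y -` A \<inter> space M)" for c
  proof (rule expectation_mult_indicator_of_char_real[where K = "norm c * K"])
    fix \<omega>
    have "\<bar>Re (c * W \<omega>)\<bar> \<le> norm (c * W \<omega>)" by (rule abs_Re_le_cmod)
    also have "\<dots> \<le> norm c * K" unfolding norm_mult by (intro mult_left_mono bound) simp
    finally show "\<bar>Re (c * W \<omega>)\<bar> \<le> norm c * K" .
  next
    fix t
    \<comment> \<open>Writing the real part as half of a number plus its conjugate produces the
      conjugate of an expectation at \<open>- t\<close>. The assumption on \<open>W\<close> applies
      there too, and \<open>cnj_char_minus\<close> leads back to \<open>t\<close>.\<close>
    have "expectation (\<lambda>\<omega>. Re (c * W \<omega>) *\<^sub>R iexp (t * Y \<omega>)) =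
      expectation (\<lambda>\<omega>. (c / 2) * (W \<omega> * iexp (t * Y \<omega>)) + cnj ((c / 2) * (W \<omega> * iexp ((- t) * Y \<omega>))))"
    proof (rule Bochner_Integration.integral_cong[OF refl])
      fix \<omega>
      have "cnj (iexp ((- t) * Y \<omega>)) = iexp (t * Y \<omega>)" by (simp add: exp_cnj)
      moreover have "of_real (Re (c * W \<omega>)) = (c * W \<omega> + cnj (c * W \<omega>)) / 2"
        by (simp add: complex_eq_iff)
      ultimately show "Re (c * W \<omega>) *\<^sub>R iexp (t * Y \<omega>) =
        (c / 2) * (W \<omega> * iexp (t * Y \<omega>)) + cnj ((c / 2) * (W \<omega> * iexp ((- t) * Y \<omega>)))"
        by (simp only: scaleR_conv_of_real complex_cnj_mult complex_cnj_divide complex_cnj_numeral)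
          (simp add: algebra_simps)
    qed
    also have "\<dots> = (c / 2) * expectation (\<lambda>\<omega>. W \<omega> * iexp (t * Y \<omega>)) +
        cnj ((c / 2) * expectation (\<lambda>\<omega>. W \<omega> * iexp ((- t) * Y \<omega>)))"
    proof -
      have i1: "integrable M (\<lambda>\<omega>. (c / 2) * (W \<omega> * iexp (s * Y \<omega>)))" for s
        by (intro integrable_mult_right int) auto
      show ?thesis
        by (subst Bochner_Integration.integral_add[OF i1 integrable_cnj[OF i1]]) (simp only: Bochner_Integration.integral_cnj integral_mult_right_zero)
    qed
    also have "\<dots> = of_real (Re (c * expectation W)) * char (distr M borel Y) t"
    proof -
      have "of_real (Re (c * expectation W)) = (c * expectation W + cnj (c * expectation W)) / 2"
        by (simp add: complex_eq_iff)
      then show ?thesis unfolding char using dY.cnj_char_minus[of t]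
        by (simp only: complex_cnj_mult complex_cnj_divide complex_cnj_numeral) (simp add: algebra_simps)
    qed
    also have "Re (c * expectation W) = expectation (\<lambda>\<omega>. Re (c * W \<omega>))"
      using intW by (subst integral_Re) auto
    finally show "expectation (\<lambda>\<omega>. Re (c * W \<omega>) *\<^sub>R iexp (t * Y \<omega>)) =
      expectation (\<lambda>\<omega>. Re (c * W \<omega>)) *\<^sub>R char (distr M borel Y) t"
      by (simp add: scaleR_conv_of_real)
  qed auto
  have intA: "integrable M (\<lambda>\<omega>. W \<omega> * of_real (indicat_real A (Y \<omega>)))"
    by (intro int) (auto simp: indicator_def)
  show ?thesis
  proof (rule complex_eqI)
    show "Re (expectation (\<lambda>\<omega>. W \<omega> * of_real (indicat_real A (Y \<omega>)))) =
      Re (expectation W * of_real (prob (Y -` A \<inter> space M)))"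
      using part[of 1] intA intW by (simp flip: integral_Re)
    show "Im (expectation (\<lambda>\<omega>. W \<omega> * of_real (indicat_real A (Y \<omega>)))) =
      Im (expectation W * of_real (prob (Y -` A \<inter> space M)))"
      using part[of "- \<i>"] intA intW by (simp flip: integral_Im)
  qed
qed

text \<open>Kac's theorem. The mixed identity \<open>*\<close> interpolates between the assumption
  on characteristic functions (\<open>J\<close> empty) and the product rule for events
  (\<open>J = I\<close>).\<close>

theorem (in prob_space) indep_vars_of_char_prod:
  fixes Y :: "'i \<Rightarrow> 'a \<Rightarrow> real"
  assumes I: "finite I" "I \<noteq> {}" and Y: "\<And>i. i \<in> I \<Longrightarrow> Y i \<in> borel_measurable M"
    and char: "\<And>t. expectation (\<lambda>\<omega>. iexp (\<Sum>i\<in>I. t i * Y i \<omega>)) =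
      (\<Prod>i\<in>I. char (distr M borel (Y i)) (t i))"
  shows "indep_vars (\<lambda>_. borel) Y I"
proof -
  \<comment> \<open>The exponential factors are replaced by indicators one coordinate at a time.\<close>
  have *: "expectation (\<lambda>\<omega>. (\<Prod>j\<in>J. of_real (indicat_real (A j) (Y j \<omega>))) * iexp (\<Sum>i\<in>I - J. t i * Y i \<omega>)) =
      (\<Prod>j\<in>J. of_real (prob (Y j -` A j \<inter> space M))) * (\<Prod>i\<in>I - J. char (distr M borel (Y i)) (t i))"
    if A[measurable]: "\<And>j. A j \<in> sets borel" and "finite J" "J \<subseteq> I" for A J t
    using that(2,3)
  proof (induction arbitrary: t)
    case empty
    show ?case using char[of t] by simp
  next
    case (insert j J)
    then have j: "j \<in> I" "j \<notin> J" and J: "J \<subseteq> I" by auto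
    let ?R = "I - insert j J"
    have IJ: "I - J = insert j ?R" "j \<notin> ?R" "finite ?R" using j J I by auto
    have YJ[measurable]: "\<And>i. i \<in> J \<Longrightarrow> Y i \<in> borel_measurable M" using Y J by auto
    have YR[measurable]: "\<And>i. i \<in> ?R \<Longrightarrow> Y i \<in> borel_measurable M" using Y by auto
    interpret dY: real_distribution "distr M borel (Y j)" using Y[OF j(1)] by (simp add: real_distribution_distr)
    \<comment> \<open>The weight collects every factor except the one at \<open>j\<close>: the
      indicators obtained so far and the exponentials still to be replaced.\<close>
    define W where "W \<omega> = (\<Prod>j\<in>J. complex_of_real (indicat_real (A j) (Y j \<omega>))) * iexp (\<Sum>i\<in>?R. t i * Y i \<omega>)" for \<omega>
    define P where "P = (\<Prod>j\<in>J. complex_of_real (prob (Y j -` A j \<inter> space M)))"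
    define Q where "Q = (\<Prod>i\<in>?R. char (distr M borel (Y i)) (t i))"
    have step: "expectation (\<lambda>\<omega>. W \<omega> * iexp (s * Y j \<omega>)) = P * Q * char (distr M borel (Y j)) s" for s
    proof -
      have "(\<Sum>i\<in>?R. (t(j := s)) i * Y i \<omega>) = (\<Sum>i\<in>?R. t i * Y i \<omega>)" for \<omega>
        by (intro sum.cong) auto
      then have S: "(\<Sum>i\<in>I - J. (t(j := s)) i * Y i \<omega>) = (\<Sum>i\<in>?R. t i * Y i \<omega>) + s * Y j \<omega>" for \<omega>
        unfolding IJ(1) using IJ(2,3) by simp
      have "(\<Prod>i\<in>?R. char (distr M borel (Y i)) ((t(j := s)) i)) = Q"
        unfolding Q_def by (intro prod.cong) auto
      then have T: "(\<Prod>i\<in>I - J. char (distr M borel (Y i)) ((t(j := s)) i)) = Q * char (distr M borel (Y j)) s"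
        unfolding IJ(1) using IJ(2,3) by simp
      show ?thesis using insert.IH[OF J, of "t(j := s)"] unfolding S T P_def[symmetric] W_def
        by (simp add: exp_add distrib_left mult.assoc)
    qed
    \<comment> \<open>At \<open>s = 0\<close> the characteristic function is 1, which identifies the
      mean of the weight.\<close>
    have EW: "expectation W = P * Q" using step[of 0] dY.char_zero by simp
    have "expectation (\<lambda>\<omega>. W \<omega> * of_real (indicat_real (A j) (Y j \<omega>))) =
      expectation W * of_real (prob (Y j -` A j \<inter> space M))"
    proof (rule expectation_mult_indicator_of_char[where K = 1])
      show "W \<in> borel_measurable M" unfolding W_def by measurable
      show "norm (W \<omega>) \<le> 1" for \<omega>
        by (auto simp: W_def norm_mult prod_norm[symmetric] indicator_def intro!: prod_le_1)
    qed (use Y[OF j(1)] step EW A in auto)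
    then show ?case unfolding EW
      using insert.hyps by (simp add: W_def P_def Q_def ac_simps)
  qed
  show ?thesis
    unfolding indep_vars_def2
  proof (intro conjI ballI)
    show "indep_sets (\<lambda>i. {Y i -` A \<inter> space M |A. A \<in> sets borel}) I"
    proof (subst indep_sets_finite[OF I(2,1)])
      show "\<forall>E\<in>\<Pi> i\<in>I. {Y i -` A \<inter> space M |A. A \<in> sets borel}. prob (\<Inter> (E ` I)) = (\<Prod>j\<in>I. prob (E j))"
      proof
        fix E assume "E \<in> (\<Pi> i\<in>I. {Y i -` A \<inter> space M |A. A \<in> sets borel})"
        then have "\<forall>i\<in>I. \<exists>A. E i = Y i -` A \<inter> space M \<and> A \<in> sets borel" by auto
        then obtain A' where A': "\<And>i. i \<in> I \<Longrightarrow> E i = Y i -` A' i \<inter> space M \<and> A' i \<in> sets borel"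
          by metis
        \<comment> \<open>The identity \<open>*\<close> asks for a Borel set at every index; the
          empty set is the default outside \<open>I\<close>.\<close>
        define A where "A i = (if i \<in> I then A' i else {})" for i
        have A: "\<And>i. A i \<in> sets borel" "\<And>i. i \<in> I \<Longrightarrow> E i = Y i -` A i \<inter> space M"
          using A' by (auto simp: A_def)
        have E: "E i \<in> events" if "i \<in> I" for i using A Y that by (auto intro: measurable_sets)
        have "of_real (prob (\<Inter> (E ` I))) = expectation (\<lambda>\<omega>. complex_of_real (indicat_real (\<Inter> (E ` I)) \<omega>))"
          using E I by (subst integral_complex_of_real) (simp add: sets.finite_INT)
        also have "\<dots> = expectation (\<lambda>\<omega>. \<Prod>j\<in>I. of_real (indicat_real (A j) (Y j \<omega>)))"
        proof (rule Bochner_Integration.integral_cong[OF refl])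
          fix \<omega> assume "\<omega> \<in> space M"
          then have "(\<Prod>j\<in>I. indicat_real (A j) (Y j \<omega>)) = (\<Prod>j\<in>I. indicat_real (E j) \<omega>)"
            using A(2) by (intro prod.cong) (auto simp: indicator_def)
          also have "\<dots> = indicat_real (\<Inter> (E ` I)) \<omega>" using I
            by (auto simp: indicator_def)
          finally show "complex_of_real (indicat_real (\<Inter> (E ` I)) \<omega>) = (\<Prod>j\<in>I. of_real (indicat_real (A j) (Y j \<omega>)))"
            by (simp flip: of_real_prod)
        qed
        also have "\<dots> = of_real (\<Prod>j\<in>I. prob (E j))" using *[OF A(1) I(1) subset_refl] A(2) by simp
        finally show "prob (\<Inter> (E ` I)) = (\<Prod>j\<in>I. prob (E j))" by (simp only: of_real_eq_iff)
      qed
    next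
      fix i assume "i \<in> I"
      then show "{Y i -` A \<inter> space M |A. A \<in> sets borel} \<subseteq> events"
        using Y by (auto intro: measurable_sets)
      show "space M \<in> {Y i -` A \<inter> space M |A. A \<in> sets borel}"
        by (auto intro!: exI[of _ UNIV])
    qed
  qed (use Y in auto)
qed

subsection \<open>Strict positive definiteness of the covariance\<close>

text \<open>Carries the gauge integrals of powers over to Lebesgue integrability; for nonnegative
  functions the two notions agree.\<close>

lemma integrable_lborel_of_has_integral:
  fixes f :: "real \<Rightarrow> real"
  assumes [measurable]: "f \<in> borel_measurable borel" "S \<in> sets borel"
    and nonneg: "\<And>x. 0 \<le> f x" and I: "(f has_integral I) S"
  shows "integrable lborel (\<lambda>x. indicator S x * f x)"
proof -
  have "(\<lambda>x. indicator S x * f x) = (\<lambda>x. if x \<in> S then f x else 0)"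
    by (auto simp: indicator_def)
  then have "((\<lambda>x. indicator S x * f x) has_integral I) UNIV"
    using I by (simp only: has_integral_restrict_UNIV)
  from nn_integral_has_integral_lborel[OF _ _ this] nonneg show ?thesis
    by (intro integrableI_nonneg) auto
qed

text \<open>The half-angle formula reduces this to |sin y| \<le> |y|. The quadratic bound makes the
  spectral integral converge at 0.\<close>

lemma one_minus_cos_le: "1 - cos x \<le> x\<^sup>2 / 2" for x :: real
proof -
  have "1 - cos x = 2 * (sin (x / 2))\<^sup>2"
    using cos_double_sin[of "x / 2"] by simp
  also have "\<dots> = 2 * \<bar>sin (x / 2)\<bar>\<^sup>2" by simp
  also have "\<dots> \<le> 2 * \<bar>x / 2\<bar>\<^sup>2"
    by (intro mult_left_mono power_mono abs_sin_x_le_abs_x) auto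
  finally show ?thesis by (simp add: power2_eq_square)
qed

text \<open>Up to a constant, the spectral density in the harmonizable representation of fractional
  Brownian motion. Positive frequencies suffice because the integrands are even.\<close>

definition spectral_weight :: "real \<Rightarrow> real \<Rightarrow> real" where
  "spectral_weight H x = indicator {0<..} x * x powr (- 1 - 2 * H)"

lemma spectral_weight_nonneg: "0 \<le> spectral_weight H x"
  by (simp add: spectral_weight_def)

lemma borel_measurable_spectral_weight[measurable]: "spectral_weight H \<in> borel_measurable borel"
  unfolding spectral_weight_def by measurable

text \<open>On (0, 1] the quadratic bound leaves \<open>x powr (1 - 2 * H)\<close>, integrable since
  \<open>H < 1\<close>. Beyond 1 the integrand is at most \<open>2 * x powr (- 1 - 2 * H)\<close>,
  integrable since \<open>0 < H\<close>.\<close>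

lemma integrable_one_minus_cos_spectral_weight_unit:
  assumes H: "0 < H" "H < 1"
  shows "integrable lborel (\<lambda>x. (1 - cos x) * spectral_weight H x)"
proof (rule Bochner_Integration.integrable_bound)
  let ?f = "\<lambda>x. indicator {0..1} x * x powr (1 - 2 * H)"
  let ?g = "\<lambda>x. indicator {1..} x * x powr (- 1 - 2 * H)"
  have "integrable lborel ?f"
    by (rule integrable_lborel_of_has_integral[OF _ _ _ has_integral_powr_from_0]) (use H in auto)
  moreover have "integrable lborel ?g"
    by (rule integrable_lborel_of_has_integral[OF _ _ _ has_integral_powr_to_inf]) (use H in auto)
  ultimately show "integrable lborel (\<lambda>x. ?f x + 2 * ?g x)" by simp
  show "AE x in lborel. norm ((1 - cos x) * spectral_weight H x) \<le> norm (?f x + 2 * ?g x)"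
  proof (rule AE_I2)
    fix x :: real
    have "(1 - cos x) * spectral_weight H x \<le> ?f x + 2 * ?g x"
    proof (cases "0 < x")
      case True
      show ?thesis
      proof (cases "x \<le> 1")
        case x1: True
        have "1 - cos x \<le> x\<^sup>2"
          using one_minus_cos_le[of x] zero_le_power2[of x] by linarith
        then have "(1 - cos x) * spectral_weight H x \<le> x\<^sup>2 * x powr (- 1 - 2 * H)"
          using True by (auto simp: spectral_weight_def intro!: mult_right_mono)
        also have "\<dots> = x powr (1 - 2 * H)"
          using True powr_add[of x 2 "- 1 - 2 * H"] by simp
        also have "\<dots> \<le> ?f x + 2 * ?g x" using True x1 by (simp add: indicator_def)
        finally show ?thesis .
      next
        case False
        have "1 - cos x \<le> 2" using cos_ge_minus_one[of x] by linarith
        with True False show ?thesis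
          by (auto simp: spectral_weight_def indicator_def intro!: mult_right_mono)
      qed
    qed (auto simp: spectral_weight_def)
    then show "norm ((1 - cos x) * spectral_weight H x) \<le> norm (?f x + 2 * ?g x)"
      using spectral_weight_nonneg[of H x] by (simp add: abs_mult)
  qed
qed simp

definition spectral_const :: "real \<Rightarrow> real" where
  "spectral_const H = (LBINT x. (1 - cos x) * spectral_weight H x)"

lemma spectral_const_nonneg: "0 \<le> spectral_const H"
  unfolding spectral_const_def
  by (intro Bochner_Integration.integral_nonneg) (simp add: spectral_weight_nonneg)

lemma spectral_weight_scale:
  assumes "0 < t"
  shows "spectral_weight H (x / t) = t powr (1 + 2 * H) * spectral_weight H x"
proof -
  have "(x / t) powr (- 1 - 2 * H) = x powr (- 1 - 2 * H) * t powr (1 + 2 * H)" if "0 < x"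
  proof -
    have "- 1 - 2 * H = - (1 + 2 * H)" by simp
    then show ?thesis
      using that assms by (simp only: powr_divide powr_minus) (simp add: field_simps)
  qed
  then show ?thesis using assms by (auto simp: spectral_weight_def indicator_def zero_less_divide_iff)
qed

text \<open>Substitute x / |u| for x: the weight is homogeneous of degree -1 - 2H and the
  differential contributes one factor 1 / |u|. At \<open>u = 0\<close> both sides are 0, as
  \<open>0 powr a = 0\<close>.\<close>

lemma has_bochner_integral_one_minus_cos:
  assumes H: "0 < H" "H < 1"
  shows "has_bochner_integral lborel (\<lambda>x. (1 - cos (u * x)) * spectral_weight H x)
    (\<bar>u\<bar> powr (2 * H) * spectral_const H)"
proof (cases "u = 0")
  case False
  define t where "t = \<bar>u\<bar>"
  have t: "0 < t" using False by (simp add: t_def)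
  have cos_t: "cos (u * x) = cos (t * x)" for x by (auto simp: t_def abs_if)
  let ?f = "\<lambda>x. (1 - cos (t * x)) * spectral_weight H x"
  have scale: "?f (0 + (1 / t) * x) = t powr (1 + 2 * H) * ((1 - cos x) * spectral_weight H x)" for x
    using spectral_weight_scale[OF t, of H x] t by simp
  have "integrable lborel (\<lambda>x. ?f (0 + (1 / t) * x))"
    unfolding scale by (intro integrable_mult_right integrable_one_minus_cos_spectral_weight_unit H)
  then have "integrable lborel ?f"
    using t by (subst (asm) lborel_integrable_real_affine_iff) auto
  moreover have "integral\<^sup>L lborel ?f = t powr (2 * H) * spectral_const H"
    using t
    by (subst lborel_integral_real_affine[of "1 / t" ?f 0])
      (simp_all only: scale integral_mult_right_zero spectral_const_def[symmetric], auto simp: powr_add)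
  ultimately show ?thesis unfolding cos_t t_def[symmetric]
    by (simp add: has_bochner_integral_iff)
qed (auto intro: has_bochner_integral_zero)

text \<open>For fixed \<open>x\<close> the integrand is the Gram kernel of \<open>t \<mapsto> 1 - e\<^sup>i\<^sup>t\<^sup>x\<close>, so the covariance is a
  mixture of Gram kernels.\<close>

lemma has_bochner_integral_fbm_cov:
  assumes H: "0 < H" "H < 1" and st: "0 \<le> s" "0 \<le> t"
  shows "has_bochner_integral lborel
    (\<lambda>x. Re ((1 - cis (s * x)) * cnj (1 - cis (t * x))) * spectral_weight H x)
    (2 * spectral_const H * fbm_cov H s t)"
proof -
  let ?w = "spectral_weight H"
  \<comment> \<open>The real part is 1 - cos(s x) - cos(t x) + cos((s - t) x), regrouped here to
    match the three terms of \<open>fbm_cov\<close>.\<close>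
  have "Re ((1 - cis (s * x)) * cnj (1 - cis (t * x))) * ?w x =
      (1 - cos (s * x)) * ?w x + (1 - cos (t * x)) * ?w x - (1 - cos ((s - t) * x)) * ?w x" for x
    by (simp add: cos_diff left_diff_distrib) (simp add: algebra_simps)
  moreover have "2 * spectral_const H * fbm_cov H s t =
      \<bar>s\<bar> powr (2 * H) * spectral_const H + \<bar>t\<bar> powr (2 * H) * spectral_const H
      - \<bar>s - t\<bar> powr (2 * H) * spectral_const H"
    using st by (simp add: fbm_cov_def field_simps)
  ultimately show ?thesis
    using has_bochner_integral_diff[OF has_bochner_integral_add[OF
      has_bochner_integral_one_minus_cos[OF H, of s] has_bochner_integral_one_minus_cos[OF H, of t]]
      has_bochner_integral_one_minus_cos[OF H, of "s - t"]]
    by (simp only:)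

qed

lemma Re_of_real_mult: "Re (of_real r * z) = r * Re z"
  by simp

lemma cmod_sum_squared:
  "(cmod (\<Sum>i\<in>A. of_real (c i) * z i))\<^sup>2 = (\<Sum>i\<in>A. \<Sum>j\<in>A. c i * c j * Re (z i * cnj (z j)))"
proof -
  have "(cmod (\<Sum>i\<in>A. of_real (c i) * z i))\<^sup>2 =
      Re ((\<Sum>i\<in>A. of_real (c i) * z i) * cnj (\<Sum>i\<in>A. of_real (c i) * z i))"
    by (metis Re_complex_of_real complex_norm_square)
  also have "\<dots> = (\<Sum>i\<in>A. \<Sum>j\<in>A. Re (of_real (c i * c j) * (z i * cnj (z j))))"
    by (simp only: cnj_sum complex_cnj_mult complex_cnj_complex_of_real sum_product Re_sum)
      (simp add: mult_ac)
  finally show ?thesis by (simp only: Re_of_real_mult)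
qed

text \<open>Summing the Gram kernels produces a squared modulus under the integral, so the sign of
  the quadratic form becomes visible.\<close>

lemma has_bochner_integral_fbm_cov_quadratic:
  assumes H: "0 < H" "H < 1" and t: "\<And>i. i \<in> A \<Longrightarrow> 0 \<le> t i"
  shows "has_bochner_integral lborel
    (\<lambda>x. (cmod (\<Sum>i\<in>A. of_real (c i) * (1 - cis (t i * x))))\<^sup>2 * spectral_weight H x)
    (2 * spectral_const H * (\<Sum>i\<in>A. \<Sum>j\<in>A. c i * c j * fbm_cov H (t i) (t j)))"
proof -
  have "has_bochner_integral lborel
    (\<lambda>x. \<Sum>i\<in>A. \<Sum>j\<in>A. c i * c j *
      (Re ((1 - cis (t i * x)) * cnj (1 - cis (t j * x))) * spectral_weight H x))
    (\<Sum>i\<in>A. \<Sum>j\<in>A. c i * c j * (2 * spectral_const H * fbm_cov H (t i) (t j)))"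
    by (intro has_bochner_integral_sum has_bochner_integral_mult_right has_bochner_integral_fbm_cov H t)
  moreover have "(cmod (\<Sum>i\<in>A. of_real (c i) * (1 - cis (t i * x))))\<^sup>2 * spectral_weight H x =
      (\<Sum>i\<in>A. \<Sum>j\<in>A. c i * c j *
        (Re ((1 - cis (t i * x)) * cnj (1 - cis (t j * x))) * spectral_weight H x))" for x
    unfolding cmod_sum_squared sum_distrib_right by (simp only: mult.assoc)
  moreover have "2 * spectral_const H * (\<Sum>i\<in>A. \<Sum>j\<in>A. c i * c j * fbm_cov H (t i) (t j)) =
      (\<Sum>i\<in>A. \<Sum>j\<in>A. c i * c j * (2 * spectral_const H * fbm_cov H (t i) (t j)))"
    unfolding sum_distrib_left by (simp only: mult_ac)
  ultimately show ?thesis by (simp only:)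
qed

text \<open>All frequencies are integer multiples of \<open>h\<close>, so the sum is a polynomial in
  \<open>cis (h * x)\<close>. Its coefficient of degree \<open>k + 1\<close> is minus
  \<open>c k\<close>, so it has finitely many roots.\<close>

lemma finite_zeros_trigonometric_sum:
  fixes c :: "nat \<Rightarrow> real"
  assumes h: "0 < h" and c: "k < N" "c k \<noteq> 0"
  shows "finite {x \<in> {0<..<pi / h}. (\<Sum>i<N. of_real (c i) * (1 - cis (real (i + 1) * h * x))) = 0}"
    (is "finite ?Z")
proof -
  define p where "p = (\<Sum>i<N. Polynomial.smult (complex_of_real (c i)) (1 - Polynomial.monom 1 (i + 1)))"
  have "poly.coeff p (k + 1) = (\<Sum>i<N. - (if i = k then complex_of_real (c k) else 0))"
    unfolding p_def coeff_sum by (intro sum.cong refl) auto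
  also have "\<dots> = - complex_of_real (c k)" using c by (simp add: sum_negf)
  finally have "p \<noteq> 0" using c by auto
  have "poly p (cis (h * x)) = (\<Sum>i<N. of_real (c i) * (1 - cis (real (i + 1) * h * x)))" for x
    unfolding p_def poly_sum poly_smult poly_diff poly_monom poly_1 Complex.DeMoivre
    by (simp only: mult_1 mult.assoc)
  then have "(\<lambda>x. cis (h * x)) ` ?Z \<subseteq> {z. poly p z = 0}" by auto
  then have "finite ((\<lambda>x. cis (h * x)) ` ?Z)"
    using poly_roots_finite[OF \<open>p \<noteq> 0\<close>] finite_subset by blast
  moreover have "inj_on (\<lambda>x. cis (h * x)) ?Z"
  proof (rule inj_onI)
    fix x y assume xy: "x \<in> ?Z" "y \<in> ?Z" "cis (h * x) = cis (h * y)"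
    \<comment> \<open>On the chosen interval \<open>h * x\<close> stays within [0, pi], where the
      cosine alone is injective.\<close>
    then have "cos (h * x) = cos (h * y)" by (simp add: complex_eq_iff)
    moreover have "0 \<le> h * x" "h * x \<le> pi" "0 \<le> h * y" "h * y \<le> pi"
      using xy h by (auto simp: field_simps)
    ultimately have "h * x = h * y" by (rule cos_inj_pi[rotated 4])
    with h show "x = y" by simp
  qed
  ultimately show ?thesis by (rule finite_imageD)
qed

text \<open>If the spectral integral were zero, its integrand would vanish almost everywhere. On (0,
  pi / h), however, the weight is positive and the trigonometric sum has only finitely many
  zeros.\<close>

lemma fbm_cov_quadratic_pos:
  fixes c :: "nat \<Rightarrow> real"
  assumes H: "0 < H" "H < 1" and h: "0 < h" and c: "k < N" "c k \<noteq> 0"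
  shows "0 < (\<Sum>i<N. \<Sum>j<N. c i * c j * fbm_cov H (obs_time h (i + 1)) (obs_time h (j + 1)))"
    (is "0 < ?Q")
proof -
  let ?S = "\<lambda>x. \<Sum>i<N. complex_of_real (c i) * (1 - cis (obs_time h (i + 1) * x))"
  let ?f = "\<lambda>x. (cmod (?S x))\<^sup>2 * spectral_weight H x"
  have int: "has_bochner_integral lborel ?f (2 * spectral_const H * ?Q)"
    by (rule has_bochner_integral_fbm_cov_quadratic[OF H]) (use h in \<open>auto simp: obs_time_def\<close>)
  have nonneg: "0 \<le> ?f x" for x by (simp add: spectral_weight_nonneg)
  have "integral\<^sup>L lborel ?f \<noteq> 0"
  proof
    assume "integral\<^sup>L lborel ?f = 0"
    then have "AE x in lborel. ?f x = 0"
      using integral_nonneg_eq_0_iff_AE[OF integrable.intros[OF int]] nonneg by auto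
    moreover have "finite {x \<in> {0<..<pi / h}. ?S x = 0}"
      using finite_zeros_trigonometric_sum[of h k N c, OF h c] by (simp add: obs_time_def)
    then have "AE x in lborel. x \<notin> {x \<in> {0<..<pi / h}. ?S x = 0}"
      by (intro AE_not_in) (auto simp: finite_imp_null_set_lborel)
    ultimately have "AE x in lborel. x \<notin> {0<..<pi / h}"
      by eventually_elim (auto simp: spectral_weight_def)
    then have "emeasure lborel {0<..<pi / h} = 0"
      by (subst (asm) AE_iff_measurable[OF _ refl]) (auto simp: greaterThanLessThan_def greaterThan_def lessThan_def Int_def)
    with h show False by simp
  qed
  moreover have "0 \<le> integral\<^sup>L lborel ?f" using nonneg by (intro Bochner_Integration.integral_nonneg) auto
  moreover have "integral\<^sup>L lborel ?f = 2 * spectral_const H * ?Q"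
    using int by (rule has_bochner_integral_integral_eq)
  ultimately have "0 < 2 * spectral_const H * ?Q" by linarith
  \<comment> \<open>A positive product with a nonnegative first factor: both factors are
    positive.\<close>
  then show ?thesis using spectral_const_nonneg[of H] by (simp add: zero_less_mult_iff)
qed

subsection \<open>Gaussian vectors\<close>

text \<open>The normal and the degenerate case both give integrability of \<open>X - \<mu>\<close>
  and its square for some \<mu>; expanding around \<mu> yields the claim.\<close>

lemma (in prob_space) integrable_gaussian_rv:
  assumes "gaussian_rv M X"
  shows "integrable M X" "integrable M (\<lambda>\<omega>. (X \<omega>)\<^sup>2)"
proof -
  have X[measurable]: "X \<in> borel_measurable M" using assms by (simp add: gaussian_rv_def)
  obtain \<mu> where 1: "integrable M (\<lambda>\<omega>. X \<omega> - \<mu>)" and 2: "integrable M (\<lambda>\<omega>. (X \<omega> - \<mu>)\<^sup>2)"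
  proof (atomize_elim, use assms in \<open>unfold gaussian_rv_def, elim conjE disjE exE\<close>)
    fix \<mu> \<sigma> :: real
    assume \<sigma>: "0 < \<sigma>" and D: "distributed M lborel X (\<lambda>x. ennreal (normal_density \<mu> \<sigma> x))"
    have "integrable M (\<lambda>\<omega>. (X \<omega> - \<mu>) ^ k)" for k
      using distributed_integrable[OF D, of "\<lambda>x. (x - \<mu>) ^ k"] integrable_normal_moment[OF \<sigma>, of \<mu> k]
      by (simp add: normal_density_nonneg)
    from this[of 1] this[of 2] show "\<exists>\<mu>. integrable M (\<lambda>\<omega>. X \<omega> - \<mu>) \<and> integrable M (\<lambda>\<omega>. (X \<omega> - \<mu>)\<^sup>2)"
      by auto
  next
    fix \<mu> assume "AE \<omega> in M. X \<omega> = \<mu>"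
    then have "integrable M (\<lambda>\<omega>. X \<omega> - \<mu>)" "integrable M (\<lambda>\<omega>. (X \<omega> - \<mu>)\<^sup>2)"
      by (auto intro!: integrable_const_bound[where B = 0] elim!: eventually_mono)
    then show "\<exists>\<mu>. integrable M (\<lambda>\<omega>. X \<omega> - \<mu>) \<and> integrable M (\<lambda>\<omega>. (X \<omega> - \<mu>)\<^sup>2)" by blast
  qed
  from 1 have "integrable M (\<lambda>\<omega>. (X \<omega> - \<mu>) + \<mu>)" by (intro Bochner_Integration.integrable_add) auto
  then show "integrable M X" by simp
  from 1 2 have "integrable M (\<lambda>\<omega>. ((X \<omega> - \<mu>)\<^sup>2 + 2 * \<mu> * (X \<omega> - \<mu>)) + \<mu>\<^sup>2)"
    by (intro Bochner_Integration.integrable_add integrable_mult_right) auto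
  also have "(\<lambda>\<omega>. ((X \<omega> - \<mu>)\<^sup>2 + 2 * \<mu> * (X \<omega> - \<mu>)) + \<mu>\<^sup>2) = (\<lambda>\<omega>. (X \<omega>)\<^sup>2)"
    by (simp add: fun_eq_iff power2_eq_square algebra_simps)
  finally show "integrable M (\<lambda>\<omega>. (X \<omega>)\<^sup>2)" .
qed

text \<open>A centred degenerate law obeys the normal formula with variance 0, so sums over a
  process can be treated without distinguishing the two cases.\<close>

lemma (in prob_space) char_gaussian_rv:
  assumes X: "gaussian_rv M X" and mean: "expectation X = 0"
  shows "char (distr M borel X) t = exp (- (t\<^sup>2 * expectation (\<lambda>\<omega>. (X \<omega>)\<^sup>2)) / 2)"
proof -
  have Xm[measurable]: "X \<in> borel_measurable M" using X by (simp add: gaussian_rv_def)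
  consider (normal) \<mu> \<sigma> where "0 < \<sigma>" "distributed M lborel X (\<lambda>x. ennreal (normal_density \<mu> \<sigma> x))"
    | (const) \<mu> where "AE \<omega> in M. X \<omega> = \<mu>"
    using X by (auto simp: gaussian_rv_def)
  then show ?thesis
  proof cases
    case normal
    have \<mu>: "\<mu> = 0" using normal_distributed_expectation[OF normal] mean by simp
    have var: "expectation (\<lambda>\<omega>. (X \<omega>)\<^sup>2) = \<sigma>\<^sup>2"
      using normal_distributed_variance[OF normal] mean by simp
    have "distributed M lborel (\<lambda>\<omega>. X \<omega> / \<sigma>) std_normal_density"
      using normal_standard_normal_convert[OF normal(1), of X \<mu>] normal(2) \<mu> by simp
    then have "distr M lborel (\<lambda>\<omega>. X \<omega> / \<sigma>) = std_normal_distribution"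
      by (rule distributed_distr_eq_density)
    then have std: "distr M borel (\<lambda>\<omega>. X \<omega> / \<sigma>) = std_normal_distribution"
      by (simp cong: distr_cong)
    have "char (distr M borel X) t = expectation (\<lambda>\<omega>. iexp (t * X \<omega>))"
      by (simp add: char_def integral_distr)
    also have "\<dots> = char (distr M borel (\<lambda>\<omega>. X \<omega> / \<sigma>)) (t * \<sigma>)"
      using normal(1) by (simp add: char_def integral_distr)
    also have "\<dots> = exp (- (t * \<sigma>)\<^sup>2 / 2)" unfolding std char_std_normal_distribution by simp
    finally show ?thesis by (simp add: var power_mult_distrib)
  next
    case const
    have "expectation X = expectation (\<lambda>_. \<mu>)" using const by (intro integral_cong_AE) auto
    with mean have \<mu>: "\<mu> = 0" by (simp add: prob_space)
    have "char (distr M borel X) t = expectation (\<lambda>\<omega>. iexp (t * X \<omega>))"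
      by (simp add: char_def integral_distr)
    also have "\<dots> = expectation (\<lambda>_. 1)" using const \<mu> by (intro integral_cong_AE) auto
    also have "\<dots> = 1" by (simp add: prob_space)
    also have "expectation (\<lambda>\<omega>. (X \<omega>)\<^sup>2) = expectation (\<lambda>_. 0)"
      using const \<mu> by (intro integral_cong_AE) auto
    ultimately show ?thesis by simp
  qed
qed

text \<open>\<open>gaussian_process\<close> sums over sets of times, whereas the data are indexed;
  injectivity of \<open>t\<close> permits the reindexing.\<close>

lemma gaussian_rv_sum_of_process:
  assumes X: "gaussian_process M I X" and t: "inj_on t A" "t ` A \<subseteq> I" and A: "finite A"
  shows "gaussian_rv M (\<lambda>\<omega>. \<Sum>i\<in>A. c i * X (t i) \<omega>)"
proof -
  have "gaussian_rv M (\<lambda>\<omega>. \<Sum>s\<in>t ` A. (c \<circ> inv_into A t) s * X s \<omega>)"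
    using X A t unfolding gaussian_process_def by blast
  then show ?thesis using t(1) by (simp add: sum.reindex cong: sum.cong)
qed

text \<open>The combination is a centred Gaussian variable, determined by its variance. That
  variance is the quadratic form of the covariance.\<close>

lemma (in prob_space) char_fractional_brownian_motion_sum:
  assumes B: "fractional_brownian_motion M H B"
    and t: "inj_on t A" "\<And>i. i \<in> A \<Longrightarrow> 0 \<le> t i" and A: "finite A"
  shows "char (distr M borel (\<lambda>\<omega>. \<Sum>i\<in>A. c i * B (t i) \<omega>)) u =
    exp (- (u\<^sup>2 * (\<Sum>i\<in>A. \<Sum>j\<in>A. c i * c j * fbm_cov H (t i) (t j))) / 2)"
proof -
  let ?X = "\<lambda>\<omega>. \<Sum>i\<in>A. c i * B (t i) \<omega>"
  have proc: "gaussian_process M {0..} B" and mean: "\<And>t. 0 \<le> t \<Longrightarrow> expectation (B t) = 0"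
    and cov: "\<And>s t. 0 \<le> s \<Longrightarrow> 0 \<le> t \<Longrightarrow> expectation (\<lambda>\<omega>. B t \<omega> * B s \<omega>) = fbm_cov H t s"
    using B by (auto simp: fractional_brownian_motion_def)
  have "gaussian_rv M ?X" using proc t A by (intro gaussian_rv_sum_of_process) auto
  moreover have single: "gaussian_rv M (B s)" if "0 \<le> s" for s
    using gaussian_rv_sum_of_process[OF proc, of "\<lambda>_. s" "{0::nat}" "\<lambda>_. 1"] that by simp
  have int: "integrable M (B s)" "integrable M (\<lambda>\<omega>. (B s \<omega>)\<^sup>2)" if "0 \<le> s" for s
    using integrable_gaussian_rv[OF single[OF that]] by auto
  have int2: "integrable M (\<lambda>\<omega>. B s \<omega> * B s' \<omega>)" if "0 \<le> s" "0 \<le> s'" for s s'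
  proof (rule Bochner_Integration.integrable_bound)
    show "integrable M (\<lambda>\<omega>. (B s \<omega>)\<^sup>2 + (B s' \<omega>)\<^sup>2)" using int that by auto
    show "(\<lambda>\<omega>. B s \<omega> * B s' \<omega>) \<in> borel_measurable M" using int that by auto
    have "\<bar>x * y\<bar> \<le> x\<^sup>2 + y\<^sup>2" for x y :: real
      using sum_squares_bound[of "\<bar>x\<bar>" "\<bar>y\<bar>"] abs_ge_zero[of "x * y"]
      unfolding power2_abs abs_mult mult.assoc by linarith
    then show "AE \<omega> in M. norm (B s \<omega> * B s' \<omega>) \<le> norm ((B s \<omega>)\<^sup>2 + (B s' \<omega>)\<^sup>2)" by simp
  qed
  have "expectation ?X = (\<Sum>i\<in>A. c i * expectation (B (t i)))"
    using int t by (subst Bochner_Integration.integral_sum) auto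
  then have "expectation ?X = 0" using mean t by simp
  moreover have "expectation (\<lambda>\<omega>. (?X \<omega>)\<^sup>2) =
      expectation (\<lambda>\<omega>. \<Sum>i\<in>A. \<Sum>j\<in>A. c i * c j * (B (t i) \<omega> * B (t j) \<omega>))"
    by (simp only: power2_eq_square sum_product mult_ac)
  then have "expectation (\<lambda>\<omega>. (?X \<omega>)\<^sup>2) = (\<Sum>i\<in>A. \<Sum>j\<in>A. c i * c j * fbm_cov H (t i) (t j))"
    using int2 t cov by (simp add: Bochner_Integration.integral_sum integrable_mult_right)
  ultimately show ?thesis using char_gaussian_rv[of ?X u] by simp
qed

text \<open>By independence over \<open>r\<close> the characteristic functions multiply, so the
  covariances in the exponent add up.\<close>

lemma (in prob_space) expectation_iexp_sum_fractional_brownian_motions: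
  assumes B: "\<And>r. r \<in> R \<Longrightarrow> fractional_brownian_motion M (H r) (B r)"
    and ind: "indep_processes M R B"
    and t: "inj_on t A" "\<And>i. i \<in> A \<Longrightarrow> 0 \<le> t i" and A: "finite A"
  shows "expectation (\<lambda>\<omega>. iexp (\<Sum>i\<in>A. c i * (\<Sum>r\<in>R. B r (t i) \<omega>))) =
    exp (- (\<Sum>i\<in>A. \<Sum>j\<in>A. c i * c j * (\<Sum>r\<in>R. fbm_cov (H r) (t i) (t j))) / 2)"
proof -
  let ?L = "\<lambda>r \<omega>. \<Sum>i\<in>A. c i * B r (t i) \<omega>"
  \<comment> \<open>Evaluation at finitely many times is measurable on the product space, so
    independence passes from the processes to their linear combinations.\<close>
  have "indep_vars (\<lambda>_. borel) (\<lambda>r \<omega>. \<Sum>i\<in>A. c i * (\<lambda>s\<in>{0..}. B r s \<omega>) (t i)) R"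
    by (rule indep_vars_compose2[OF ind[unfolded indep_processes_def],
        where Y = "\<lambda>_ f. \<Sum>i\<in>A. c i * f (t i)"]) (use t(2) in \<open>auto intro!: borel_measurable_sum borel_measurable_times measurable_component_singleton\<close>)
  also have "(\<lambda>r \<omega>. \<Sum>i\<in>A. c i * (\<lambda>s\<in>{0..}. B r s \<omega>) (t i)) = ?L"
    using t(2) by (intro ext sum.cong) auto
  finally have L: "indep_vars (\<lambda>_. borel) ?L R" .
  then have [measurable]: "\<And>r. r \<in> R \<Longrightarrow> ?L r \<in> borel_measurable M" by (simp add: indep_vars_def)
  have "expectation (\<lambda>\<omega>. iexp (\<Sum>i\<in>A. c i * (\<Sum>r\<in>R. B r (t i) \<omega>))) =
      expectation (\<lambda>\<omega>. iexp (1 * (\<Sum>r\<in>R. ?L r \<omega>)))"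
    unfolding sum_distrib_left mult_1 by (subst sum.swap) (rule refl)
  also have "\<dots> = char (distr M borel (\<lambda>\<omega>. \<Sum>r\<in>R. ?L r \<omega>)) 1"
    unfolding char_def by (subst integral_distr) auto
  also have "\<dots> = (\<Prod>r\<in>R. char (distr M borel (?L r)) 1)" by (rule char_distr_sum[OF L])
  also have "\<dots> = (\<Prod>r\<in>R. of_real (exp (- (\<Sum>i\<in>A. \<Sum>j\<in>A. c i * c j * fbm_cov (H r) (t i) (t j)) / 2)))"
    using char_fractional_brownian_motion_sum[OF B t A, of _ c 1] by (intro prod.cong) auto
  also have "\<dots> = of_real (exp (\<Sum>r\<in>R. - (\<Sum>i\<in>A. \<Sum>j\<in>A. c i * c j * fbm_cov (H r) (t i) (t j)) / 2))"
  \<comment> \<open>For infinite \<open>R\<close> the product is 1 and the sum is 0 by convention,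
    so the identity still holds.\<close>
  proof (cases "finite R")
    case True then show ?thesis by (simp only: exp_sum of_real_prod)
  qed simp
  also have "(\<Sum>r\<in>R. - (\<Sum>i\<in>A. \<Sum>j\<in>A. c i * c j * fbm_cov (H r) (t i) (t j)) / 2) =
      - (\<Sum>i\<in>A. \<Sum>j\<in>A. c i * c j * (\<Sum>r\<in>R. fbm_cov (H r) (t i) (t j))) / 2"
  proof -
    have "(\<Sum>r\<in>R. \<Sum>i\<in>A. \<Sum>j\<in>A. c i * c j * fbm_cov (H r) (t i) (t j)) =
        (\<Sum>i\<in>A. \<Sum>r\<in>R. \<Sum>j\<in>A. c i * c j * fbm_cov (H r) (t i) (t j))"
      by (rule sum.swap)
    also have "\<dots> = (\<Sum>i\<in>A. \<Sum>j\<in>A. \<Sum>r\<in>R. c i * c j * fbm_cov (H r) (t i) (t j))"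
      by (intro sum.cong refl sum.swap)
    finally show ?thesis by (simp only: sum_divide_distrib[symmetric] sum_negf sum_distrib_left)
  qed
  finally show ?thesis by simp
qed

text \<open>A combination of the new variables is a combination of the \<open>X i\<close>, and the
  orthonormality of \<open>a\<close> reduces its exponent to a sum of squares. The joint
  characteristic function then factorises.\<close>

lemma (in prob_space) whitened_gaussian_vector:
  fixes X :: "nat \<Rightarrow> 'a \<Rightarrow> real" and a g :: "nat \<Rightarrow> nat \<Rightarrow> real"
  assumes X[measurable]: "\<And>i. i < N \<Longrightarrow> X i \<in> borel_measurable M"
    and char: "\<And>c. expectation (\<lambda>\<omega>. iexp (\<Sum>i<N. c i * X i \<omega>)) =
      exp (- (\<Sum>i<N. \<Sum>j<N. c i * c j * g i j) / 2)"
    and a: "\<And>k l. k < N \<Longrightarrow> l < N \<Longrightarrow>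
      (\<Sum>i<N. \<Sum>j<N. a k i * a l j * g i j) = (if k = l then 1 else 0)"
    and N: "0 < N"
  shows "indep_vars (\<lambda>_. borel) (\<lambda>k \<omega>. \<Sum>i<N. a k i * X i \<omega>) {..<N}" (is "indep_vars _ ?Y _")
    and "k < N \<Longrightarrow> distr M borel (\<lambda>\<omega>. \<Sum>i<N. a k i * X i \<omega>) = std_normal_distribution"
proof -
  have Y[measurable]: "?Y k \<in> borel_measurable M" for k by measurable
  \<comment> \<open>Singletons \<open>K\<close> yield the marginal laws, the full index set the
    joint law.\<close>
  have joint: "expectation (\<lambda>\<omega>. iexp (\<Sum>k\<in>K. t k * ?Y k \<omega>)) = exp (- (\<Sum>k\<in>K. (t k)\<^sup>2) / 2)"
    if K: "K \<subseteq> {..<N}" for t K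
  proof -
    have fin: "finite K" using K finite_subset by blast
    let ?c = "\<lambda>i. \<Sum>k\<in>K. t k * a k i"
    have "(\<Sum>k\<in>K. t k * ?Y k \<omega>) = (\<Sum>i<N. ?c i * X i \<omega>)" for \<omega>
      unfolding sum_distrib_left sum_distrib_right by (subst sum.swap) (simp only: mult.assoc)
    moreover have "(\<Sum>i<N. \<Sum>j<N. ?c i * ?c j * g i j) = (\<Sum>k\<in>K. (t k)\<^sup>2)"
    proof -
      have "(\<Sum>i<N. \<Sum>j<N. ?c i * ?c j * g i j) =
          (\<Sum>i<N. \<Sum>j<N. \<Sum>k\<in>K. \<Sum>l\<in>K. t k * t l * (a k i * a l j * g i j))"
        by (simp only: sum_product, simp only: sum_distrib_right, simp only: mult_ac)
      also have "\<dots> = (\<Sum>i<N. \<Sum>k\<in>K. \<Sum>j<N. \<Sum>l\<in>K. t k * t l * (a k i * a l j * g i j))"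
        by (intro sum.cong refl sum.swap)
      also have "\<dots> = (\<Sum>k\<in>K. \<Sum>i<N. \<Sum>j<N. \<Sum>l\<in>K. t k * t l * (a k i * a l j * g i j))"
        by (rule sum.swap)
      also have "\<dots> = (\<Sum>k\<in>K. \<Sum>i<N. \<Sum>l\<in>K. \<Sum>j<N. t k * t l * (a k i * a l j * g i j))"
        by (intro sum.cong refl sum.swap)
      also have "\<dots> = (\<Sum>k\<in>K. \<Sum>l\<in>K. \<Sum>i<N. \<Sum>j<N. t k * t l * (a k i * a l j * g i j))"
        by (intro sum.cong refl sum.swap)
      also have "\<dots> = (\<Sum>k\<in>K. \<Sum>l\<in>K. t k * t l * (if k = l then 1 else 0))"
        unfolding sum_distrib_left[symmetric] using K a by (intro sum.cong refl) (auto simp: subset_iff)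
      also have "\<dots> = (\<Sum>k\<in>K. \<Sum>l\<in>K. if k = l then (t k)\<^sup>2 else 0)"
        by (intro sum.cong refl) (simp add: power2_eq_square)
      also have "\<dots> = (\<Sum>k\<in>K. (t k)\<^sup>2)" using fin by simp
      finally show ?thesis .
    qed
    ultimately show ?thesis using char[of ?c] by simp
  qed
  have char_Y: "char (distr M borel (?Y k)) s = exp (- s\<^sup>2 / 2)" if "k < N" for k s
    using joint[of "{k}" "\<lambda>_. s"] that by (simp add: char_def integral_distr)
  show "distr M borel (?Y k) = std_normal_distribution" if "k < N" for k
    using char_Y[OF that]
    by (intro Levy_uniqueness real_distribution_distr real_dist_normal_dist)
      (auto simp: char_std_normal_distribution fun_eq_iff)
  show "indep_vars (\<lambda>_. borel) ?Y {..<N}"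
  proof (rule indep_vars_of_char_prod)
    fix t
    have "expectation (\<lambda>\<omega>. iexp (\<Sum>k<N. t k * ?Y k \<omega>)) = of_real (\<Prod>k<N. exp (- (t k)\<^sup>2 / 2))"
      using joint[of "{..<N}" t] by (simp add: sum_negf flip: exp_sum sum_divide_distrib)
    then show "expectation (\<lambda>\<omega>. iexp (\<Sum>k<N. t k * ?Y k \<omega>)) =
      (\<Prod>k<N. char (distr M borel (?Y k)) (t k))"
      using char_Y by simp
  qed (use N in auto)
qed

text \<open>Independence identifies the joint law of the \<open>Y i\<close> with the product measure
  whose image defines \<open>chi_square_law\<close>.\<close>

lemma (in prob_space) distr_sum_squares_std_normal:
  assumes ind: "indep_vars (\<lambda>_. borel) Y {..<n}" and n: "0 < n"
    and std: "\<And>i. i < n \<Longrightarrow> distr M borel (Y i) = std_normal_distribution"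
  shows "distr M borel (\<lambda>\<omega>. \<Sum>i<n. (Y i \<omega>)\<^sup>2) = chi_square_law n"
proof -
  have Y: "\<And>i. i \<in> {..<n} \<Longrightarrow> Y i \<in> borel_measurable M" using ind by (simp add: indep_vars_def)
  let ?V = "\<lambda>\<omega>. \<lambda>i\<in>{..<n}. Y i \<omega>"
  have V: "?V \<in> measurable M (PiM {..<n} (\<lambda>_. borel))" using Y by (intro measurable_restrict) auto
  have "distr M (PiM {..<n} (\<lambda>_. borel)) ?V = PiM {..<n} (\<lambda>i. distr M borel (Y i))"
    using indep_vars_iff_distr_eq_PiM'[where I = "{..<n}" and M' = "\<lambda>_. borel" and X = Y] ind n Y by auto
  also have "\<dots> = PiM {..<n} (\<lambda>_. std_normal_distribution)" using std by (intro PiM_cong) auto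
  finally have "chi_square_law n = distr (distr M (PiM {..<n} (\<lambda>_. borel)) ?V) borel (\<lambda>x. \<Sum>i<n. (x i)\<^sup>2)"
    by (simp add: chi_square_law_def)
  also have "\<dots> = distr M borel ((\<lambda>x. \<Sum>i<n. (x i)\<^sup>2) \<circ> ?V)" by (rule distr_distr[OF _ V]) measurable
  also have "(\<lambda>x. \<Sum>i<n. (x i)\<^sup>2) \<circ> ?V = (\<lambda>\<omega>. \<Sum>i<n. (Y i \<omega>)\<^sup>2)" by (auto simp: fun_eq_iff)
  finally show ?thesis by simp
qed

text \<open>The index set is cut into the blocks \<open>{Suc j}\<close>; restrictions to disjoint
  blocks are independent, and the single coordinate of each is read off.\<close>

lemma (in prob_space) indep_vars_Suc:
  assumes "indep_vars (\<lambda>_. N) Y {..<Suc n}"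
  shows "indep_vars (\<lambda>_. N) (\<lambda>i. Y (Suc i)) {..<n}"
proof -
  have "indep_vars (\<lambda>j. PiM {Suc j} (\<lambda>_. N)) (\<lambda>j \<omega>. restrict (\<lambda>i. Y i \<omega>) {Suc j}) {..<n}"
    by (rule indep_vars_restrict[OF assms]) (auto simp: disjoint_family_on_def)
  then have "indep_vars (\<lambda>_. N) (\<lambda>j \<omega>. restrict (\<lambda>i. Y i \<omega>) {Suc j} (Suc j)) {..<n}"
    by (rule indep_vars_compose2[where Y = "\<lambda>j f. f (Suc j)"]) (auto intro: measurable_component_singleton)
  then show ?thesis by simp
qed

subsection \<open>The estimators\<close>

lemma fbm_cov_commute: "fbm_cov H s t = fbm_cov H t s"
  by (simp add: fbm_cov_def abs_minus_commute add.commute)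

lemma scalar_prod_mult_mat_vec:
  fixes G :: "'a :: comm_semiring_0 Matrix.mat"
  assumes "G \<in> carrier_mat n n" "u \<in> carrier_vec n" "v \<in> carrier_vec n"
  shows "scalar_prod u (G *\<^sub>v v) = (\<Sum>i<n. \<Sum>j<n. u $ i * v $ j * G $$ (i, j))"
  using assms by (auto simp: scalar_prod_def atLeast0LessThan sum_distrib_left mult_ac intro!: sum.cong)

lemma Gamma_sum_carrier: "Gamma_sum h N m H \<in> carrier_mat N N"
  by (simp add: Gamma_sum_def)

lemma Gamma_sum_index:
  assumes "i < N" "j < N"
  shows "Gamma_sum h N m H $$ (i, j) =
    (\<Sum>r=1..m. fbm_cov (H r) (obs_time h (i + 1)) (obs_time h (j + 1)))"
  using assms by (simp add: Gamma_sum_def Gamma_fbm_def)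

lemma Gamma_sum_symmetric:
  assumes "u \<in> carrier_vec N" "v \<in> carrier_vec N"
  shows "scalar_prod u (Gamma_sum h N m H *\<^sub>v v) = scalar_prod v (Gamma_sum h N m H *\<^sub>v u)"
proof -
  have "(\<Sum>i<N. \<Sum>j<N. u $ i * v $ j * Gamma_sum h N m H $$ (i, j)) =
      (\<Sum>j<N. \<Sum>i<N. u $ i * v $ j * Gamma_sum h N m H $$ (i, j))"
    by (rule sum.swap)
  also have "\<dots> = (\<Sum>j<N. \<Sum>i<N. v $ j * u $ i * Gamma_sum h N m H $$ (j, i))"
    by (intro sum.cong refl) (auto simp: Gamma_sum_index fbm_cov_commute mult_ac)
  finally show ?thesis
    by (simp only: scalar_prod_mult_mat_vec[OF Gamma_sum_carrier] assms)
qed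

text \<open>Every Hurst parameter contributes a positive quadratic form, and
  \<open>1 \<le> m\<close> makes the sum over \<open>r\<close> nonempty.\<close>

lemma Gamma_sum_pos_def:
  assumes h: "0 < h" and m: "1 \<le> m" and H: "\<And>r. r \<in> {1..m} \<Longrightarrow> H r \<in> {0<..<1}"
    and v: "v \<in> carrier_vec N" "v \<noteq> 0\<^sub>v N"
  shows "0 < scalar_prod v (Gamma_sum h N m H *\<^sub>v v)"
proof -
  obtain k where k: "k < N" "v $ k \<noteq> 0"
    using v by (metis carrier_vecD eq_vecI index_zero_vec(1,2))
  let ?q = "\<lambda>r i j. v $ i * v $ j * fbm_cov (H r) (obs_time h (i + 1)) (obs_time h (j + 1))"
  have "scalar_prod v (Gamma_sum h N m H *\<^sub>v v) = (\<Sum>i<N. \<Sum>j<N. \<Sum>r=1..m. ?q r i j)"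
    using scalar_prod_mult_mat_vec[OF Gamma_sum_carrier v(1) v(1)]
    by (simp add: Gamma_sum_index sum_distrib_left del: sum.lessThan_Suc)
  also have "\<dots> = (\<Sum>i<N. \<Sum>r=1..m. \<Sum>j<N. ?q r i j)"
    by (intro sum.cong refl sum.swap)
  also have "\<dots> = (\<Sum>r=1..m. \<Sum>i<N. \<Sum>j<N. ?q r i j)" by (rule sum.swap)
  also have "0 < \<dots>"
  proof (rule sum_pos)
    show "{1..m} \<noteq> {}" using m by simp
  next
    fix r assume "r \<in> {1..m}"
    from H[OF this] show "0 < (\<Sum>i<N. \<Sum>j<N. ?q r i j)"
      using fbm_cov_quadratic_pos[where c = "\<lambda>i. v $ i", OF _ _ h k] by simp
  qed simp
  finally show ?thesis .
qed

lemma obs_time_nonneg: "0 < h \<Longrightarrow> 0 \<le> obs_time h k"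
  by (simp add: obs_time_def)

lemma inj_on_obs_time: "0 < h \<Longrightarrow> inj_on (\<lambda>i. obs_time h (i + 1)) A"
  by (auto simp: inj_on_def obs_time_def)

theorem theorem3p6:
  fixes M :: "'a measure"
    and B :: "nat \<Rightarrow> real \<Rightarrow> 'a \<Rightarrow> real"
    and H :: "nat \<Rightarrow> real"
    and h \<theta> \<alpha> :: real
    and m N :: nat
  assumes "prob_space M"
    and "0 < h"
    and "1 \<le> m"
    and "\<And>r. r \<in> {1..m} \<Longrightarrow> H r \<in> {1/2<..<1}"
    and "\<And>r. r \<in> {1..m} \<Longrightarrow> fractional_brownian_motion M (H r) (B r)"
    and "indep_processes M {1..m} B"
    and "0 < \<alpha>"
    and "2 \<le> N"
  shows "let Z = Z_proc \<theta> \<alpha> m B in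
      (distributed M lborel (theta_hat h N m H Z)
         (\<lambda>x. ennreal (normal_density \<theta> (sqrt (\<alpha>\<^sup>2 / d_N h N m H)) x)) \<and>
       integrable M (theta_hat h N m H Z) \<and>
       prob_space.expectation M (theta_hat h N m H Z) = \<theta>) \<and>
      ((\<lambda>\<omega>. real N * alpha2_hat h N m H Z \<omega> / \<alpha>\<^sup>2) \<in> borel_measurable M \<and>
       distr M borel (\<lambda>\<omega>. real N * alpha2_hat h N m H Z \<omega> / \<alpha>\<^sup>2)
         = chi_square_law (N - 1)) \<and>
      prob_space.indep_var M borel (theta_hat h N m H Z) borel (alpha2_hat h N m H Z)"
proof -
  interpret prob_space M by fact
  note h = assms(2) and \<alpha> = assms(7)
  \<comment> \<open>\<open>n\<close> is the number of degrees of freedom: index 0 carries the drift,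
    the \<open>n\<close> indices \<open>Suc i\<close> carry the residual.\<close>
  define n where "n = N - 1"
  have N: "N = Suc n" "0 < n" "0 < N" using assms(8) by (auto simp: n_def)
  define Z where "Z = Z_proc \<theta> \<alpha> m B"
  define G where "G = Gamma_sum h N m H"
  define T where "T = T_vec h N"
  define d where "d = d_N h N m H"
  define X where "X i \<omega> = (\<Sum>r=1..m. B r (obs_time h (i + 1)) \<omega>)" for i \<omega>
  have G: "G \<in> carrier_mat N N" by (simp add: G_def Gamma_sum_carrier)
  have T: "T \<in> carrier_vec N" by (simp add: T_def T_vec_def)
  \<comment> \<open>Entry 0 belongs to the first observation time \<open>h\<close>, not to time
    0.\<close>
  have "T $ 0 \<noteq> 0" using h N by (simp add: T_def T_vec_def obs_time_def)
  then have T0: "T \<noteq> 0\<^sub>v N" using N by auto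
  have H01: "H r \<in> {0<..<1}" if "r \<in> {1..m}" for r using assms(4)[OF that] by auto
  obtain a where a: "\<And>i. i < N \<Longrightarrow> a i \<in> carrier_vec N"
    and on: "\<And>i j. i < N \<Longrightarrow> j < N \<Longrightarrow> scalar_prod (a i) (G *\<^sub>v a j) = (if i = j then 1 else 0)"
    and form: "\<And>u v. u \<in> carrier_vec N \<Longrightarrow> v \<in> carrier_vec N \<Longrightarrow>
      inv_form G u v = (\<Sum>i<N. scalar_prod (a i) u * scalar_prod (a i) v)"
    and TT: "0 < inv_form G T T" "scalar_prod (a 0) T = sqrt (inv_form G T T)"
    and aT: "\<And>i. 0 < i \<Longrightarrow> i < N \<Longrightarrow> scalar_prod (a i) T = 0"
    by (rule exists_whitening[OF G _ _ T T0])
      (use Gamma_sum_symmetric Gamma_sum_pos_def[OF h assms(3) H01] in \<open>auto simp: G_def\<close>)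
  have d: "inv_form G T T = d" "0 < d" using TT by (auto simp: d_def d_N_def G_def T_def)

  \<comment> \<open>Standard normal coordinates of the noise\<close>
  define Y where "Y k \<omega> = (\<Sum>i<N. a k $ i * X i \<omega>)" for k \<omega>
  have Xm: "X i \<in> borel_measurable M" for i
  proof -
    have "B r (obs_time h (i + 1)) \<in> borel_measurable M" if "r \<in> {1..m}" for r
    proof -
      have "gaussian_process M {0..} (B r)"
        using assms(5)[OF that] by (simp add: fractional_brownian_motion_def)
      from gaussian_rv_sum_of_process[OF this, of "\<lambda>_. obs_time h (i + 1)" "{0::nat}" "\<lambda>_. 1"]
      show ?thesis using obs_time_nonneg[OF h] by (simp add: gaussian_rv_def)
    qed
    then show ?thesis unfolding X_def by (intro borel_measurable_sum) auto
  qed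
  have charX: "expectation (\<lambda>\<omega>. iexp (\<Sum>i<N. c i * X i \<omega>)) =
      exp (- (\<Sum>i<N. \<Sum>j<N. c i * c j * G $$ (i, j)) / 2)" for c
  proof -
    have "(\<Sum>i<N. \<Sum>j<N. c i * c j * G $$ (i, j)) = (\<Sum>i<N. \<Sum>j<N. c i * c j *
        (\<Sum>r=1..m. fbm_cov (H r) (obs_time h (i + 1)) (obs_time h (j + 1))))"
      by (intro sum.cong refl) (simp add: G_def Gamma_sum_index)
    with expectation_iexp_sum_fractional_brownian_motions[OF assms(5,6)
        inj_on_obs_time[OF h] obs_time_nonneg[OF h], of "{..<N}" c]
    show ?thesis unfolding X_def by simp
  qed
  have gram: "(\<Sum>i<N. \<Sum>j<N. a k $ i * a l $ j * G $$ (i, j)) = (if k = l then 1 else 0)"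
    if "k < N" "l < N" for k l
    using on[OF that] scalar_prod_mult_mat_vec[OF G a[OF that(1)] a[OF that(2)]] by simp
  have Y_ind: "indep_vars (\<lambda>_. borel) Y {..<N}"
    unfolding Y_def[abs_def] by (rule whitened_gaussian_vector(1)[OF Xm charX gram N(3)])
  have Y_std: "distr M borel (Y k) = std_normal_distribution" if "k < N" for k
    unfolding Y_def[abs_def] by (rule whitened_gaussian_vector(2)[OF Xm charX gram N(3) that])
  have Ym: "Y k \<in> borel_measurable M" for k unfolding Y_def using Xm by measurable

  \<comment> \<open>The estimators in these coordinates\<close>
  let ?Z = "\<lambda>\<omega>. Z_vec h N Z \<omega>"
  have Zc: "?Z \<omega> \<in> carrier_vec N" for \<omega> by (simp add: Z_vec_def)
  have aZ: "scalar_prod (a k) (?Z \<omega>) = \<theta> * scalar_prod (a k) T + \<alpha> * Y k \<omega>" if "k < N" for k \<omega>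
    by (simp add: scalar_prod_def Z_vec_def T_def T_vec_def Z_def Z_proc_def Y_def X_def
      atLeast0LessThan sum_distrib_left sum.distrib[symmetric] algebra_simps)
  \<comment> \<open>Coordinate 0 of \<open>T\<close> is \<open>sqrt d\<close> and all others vanish,
    so only one term of the sum survives.\<close>
  have TZ: "inv_form G T (?Z \<omega>) = sqrt d * (\<theta> * sqrt d + \<alpha> * Y 0 \<omega>)" for \<omega>
    unfolding form[OF T Zc] unfolding N(1) sum.lessThan_Suc_shift
    using aT aZ TT N by (simp add: d)
  have ZZ: "inv_form G (?Z \<omega>) (?Z \<omega>) =
      (\<theta> * sqrt d + \<alpha> * Y 0 \<omega>)\<^sup>2 + \<alpha>\<^sup>2 * (\<Sum>i<n. (Y (Suc i) \<omega>)\<^sup>2)" for \<omega>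
    unfolding form[OF Zc Zc] unfolding N(1) sum.lessThan_Suc_shift
    using aT aZ TT N by (simp add: d power2_eq_square sum_distrib_left mult_ac)
  have theta: "theta_hat h N m H Z = (\<lambda>\<omega>. \<theta> + \<alpha> / sqrt d * Y 0 \<omega>)"
  proof
    fix \<omega>
    have "theta_hat h N m H Z \<omega> = inv_form G T (?Z \<omega>) / d"
      by (simp add: theta_hat_def G_def T_def d_def)
    also have "\<dots> = \<theta> + \<alpha> / sqrt d * Y 0 \<omega>"
      using d real_sqrt_mult_self[of d] unfolding TZ by (simp add: field_simps)
    finally show "theta_hat h N m H Z \<omega> = \<theta> + \<alpha> / sqrt d * Y 0 \<omega>" .
  qed
  have alpha: "alpha2_hat h N m H Z = (\<lambda>\<omega>. \<alpha>\<^sup>2 / N * (\<Sum>i<n. (Y (Suc i) \<omega>)\<^sup>2))"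
  proof
    fix \<omega>
    have "alpha2_hat h N m H Z \<omega> =
      1 / N * (inv_form G (?Z \<omega>) (?Z \<omega>) - (inv_form G T (?Z \<omega>))\<^sup>2 / d)"
      by (simp add: alpha2_hat_def G_def T_def d_def)
    \<comment> \<open>The subtracted square is exactly the contribution of coordinate 0, so both
      \<theta> and \<open>Y 0\<close> cancel.\<close>
    also have "\<dots> = \<alpha>\<^sup>2 / N * (\<Sum>i<n. (Y (Suc i) \<omega>)\<^sup>2)"
      using d unfolding TZ ZZ by (simp add: power_mult_distrib)
    finally show "alpha2_hat h N m H Z \<omega> = \<alpha>\<^sup>2 / N * (\<Sum>i<n. (Y (Suc i) \<omega>)\<^sup>2)" .
  qed

  \<comment> \<open>Laws and independence of the estimators\<close>
  have "distributed M lborel (Y 0) std_normal_density"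
    using Y_std[OF N(3)] Ym[of 0] by (simp add: distributed_def cong: distr_cong)
  then have "distributed M lborel (\<lambda>\<omega>. \<theta> + \<alpha> / sqrt d * Y 0 \<omega>)
      (normal_density (\<theta> + \<alpha> / sqrt d * 0) (\<bar>\<alpha> / sqrt d\<bar> * 1))"
    by (rule normal_density_affine) (use \<alpha> d in auto)
  moreover have "\<bar>\<alpha> / sqrt d\<bar> * 1 = sqrt (\<alpha>\<^sup>2 / d)" using \<alpha> d by (simp add: real_sqrt_divide)
  ultimately have law: "distributed M lborel (theta_hat h N m H Z)
      (\<lambda>x. ennreal (normal_density \<theta> (sqrt (\<alpha>\<^sup>2 / d)) x))"
    by (simp add: theta)
  have sd: "0 < sqrt (\<alpha>\<^sup>2 / d)" using \<alpha> d by simp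
  \<comment> \<open>The Bochner integral of a non-integrable function is 0 by convention, so
    integrability is established alongside the mean.\<close>
  have "gaussian_rv M (theta_hat h N m H Z)"
    using law sd Ym unfolding gaussian_rv_def theta by auto
  then have integ: "integrable M (theta_hat h N m H Z)" by (rule integrable_gaussian_rv)
  have chi: "(\<lambda>\<omega>. real N * alpha2_hat h N m H Z \<omega> / \<alpha>\<^sup>2) = (\<lambda>\<omega>. \<Sum>i<n. (Y (Suc i) \<omega>)\<^sup>2)"
    unfolding alpha using \<alpha> N(3) by simp
  have "indep_vars (\<lambda>_. borel) (\<lambda>i. Y (Suc i)) {..<n}"
    using Y_ind unfolding N(1) by (rule indep_vars_Suc)
  then have chi_law: "distr M borel (\<lambda>\<omega>. \<Sum>i<n. (Y (Suc i) \<omega>)\<^sup>2) = chi_square_law n"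
    by (rule distr_sum_squares_std_normal[OF _ N(2)]) (use Y_std N in auto)
  \<comment> \<open>Applying \<open>V k\<close> to each coordinate keeps independence. Index 0
    yields \<open>theta_hat\<close>, and the sum over the disjoint set of remaining indices yields
    \<open>alpha2_hat\<close>.\<close>
  define V where "V k x = (if k = 0 then \<theta> + \<alpha> / sqrt d * x else \<alpha>\<^sup>2 / N * x\<^sup>2)" for k :: nat and x :: real
  have split: "{..<N} = insert 0 (Suc ` {..<n})" unfolding N(1) by (rule lessThan_Suc_eq_insert_0)
  have "indep_vars (\<lambda>_. borel) (\<lambda>k \<omega>. V k (Y k \<omega>)) {..<N}"
    by (rule indep_vars_compose2[OF Y_ind]) (simp add: V_def)
  then have "indep_var borel (\<lambda>\<omega>. V 0 (Y 0 \<omega>)) borel (\<lambda>\<omega>. \<Sum>k\<in>Suc ` {..<n}. V k (Y k \<omega>))"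
    unfolding split by (intro indep_vars_sum) auto
  also have "(\<lambda>\<omega>. \<Sum>k\<in>Suc ` {..<n}. V k (Y k \<omega>)) = alpha2_hat h N m H Z"
    by (simp add: alpha sum.reindex V_def sum_distrib_left fun_eq_iff)
  also have "(\<lambda>\<omega>. V 0 (Y 0 \<omega>)) = theta_hat h N m H Z" by (simp add: theta V_def)
  finally have ind: "indep_var borel (theta_hat h N m H Z) borel (alpha2_hat h N m H Z)" .
  show ?thesis unfolding Let_def Z_def[symmetric] d_def[symmetric] chi n_def[symmetric]
    using law integ normal_distributed_expectation[OF sd law] chi_law ind Ym by auto
qed

end
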